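(* Assume the complete-graph noiseless model described in the context, with generic camera locations and with every clean triple nondegenerate. Fix $a>0$ and let $\{\rho_\sigma\}_{\sigma>0}$ be a redescending MM-admissible family at radius $a$ with constants $m_a\in(0,1]$ and $K<\infty$. Put $G_J=32/7$, $\delta_J=1/384$, $\beta_a=6G_J(1-m_a)$, assume $\beta_a<1$, and choose $\mathsf G_a\ge G_J/(1-\beta_a)$. Set $\kappa_a=\frac1{4\mathsf G_a}$, $\mu_n=\kappa_a n$, $J_a=K+a$, and let $c>0$ satisfy $c<\delta_J$ and $$12\mathsf G_a c a+6\mathsf G_aJ_a c\Big(1+\frac{12c}{\kappa_a}\Big)\Big(1+\frac3{\kappa_a}\Big)<\frac a2 .$$ Let $\{\sigma_k\}_{k\ge0}$ be any decreasing positive sequence with $\sigma_k\to0$ and $\frac{6\mathsf G_aKc}{a}<\frac{\sigma_{k+1}}{\sigma_k}<1$ for every $k$ (in particular a geometric schedule $\sigma_{k+1}=\tau\sigma_k$ is admissible whenever $\frac{6\mathsf G_aKc}{a}<\tau<1$). Let $z^{\mathrm{LS}}$ be any minimizer, in a fixed gauge, over $z\in\mathbb R^T$ of $\frac12\sum_{f\in\mathcal C}\bar w_fr_f(z)^2$, let $R_{\mathrm{LS}}=\max\{|r_f(z^{\mathrm{LS}})|:f\in\mathcal C,\ \bar w_f>0\}$, and choose $\sigma_0\ge\frac4aR_{\mathrm{LS}}$. At each scale $\sigma_k$ run an exact proximal-MM orbit $(z^{k,m})_{m\ge0}$ with proximal parameter $\mu_n$, started at $z^{0,0}=z^{\mathrm{LS}}$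 for $k=0$ and warm-started at the previous-scale output $z^{k,0}=z^{(k-1)}$ for $k\ge1$. Let $g^{k,m}$ be the selected stationarity residual at $z^{k,m}$, let $M_k=a\sigma_{k+1}-6\mathsf G_aKc\,\sigma_k>0$, stop at any finite index $m_k$ with $$\|g^{k,m_k}\|_\infty\le\frac n{\mathsf G_a}M_k ,$$ and set $z^{(k)}=z^{k,m_k}$. Then, for all sufficiently large $n$, the condition $\Delta_E\le cn$ implies all of the following: (i) every inner iterate at every scale remains in its current clean basin, i.e. $\operatorname{err}(z^{k,m}_0)\le a\sigma_k$; (ii) the stopping rule is reached after finitely many inner iterations at every scale; (iii) every stage output lies in the next clean basin: $\operatorname{err}(z_0^{(k)})\le a\sigma_{k+1}$; (iv) the clean triangle log-scales converge uniformly to ground truth up to a global additive constant: $\min_{\alpha\in\mathbb R}\max_{t\in T_0}|z_t^{(k)}-z_t^\star-\alpha|\le a\sigma_{k+1}\to0$ as $k\to\infty$. For a geometric schedule, the right-hand side of the bound in (iv) is $a\sigma_0\tau^{k+1}$.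
   Context: Setting. There are $n$ cameras with ground-truth locations $x_1^\star,\dots,x_n^\star\in\mathbb R^3$, assumed generic; $\ell_{ij}^\star=\|x_i^\star-x_j^\star\|$. The observation graph is the complete graph $K_n$, whose edges are partitioned as $E(K_n)=E_0\sqcup E_b$ (clean / corrupted), and $\Delta_E=\max_i\deg_{E_b}(i)$. Each edge carries a unit vector $d_{ij}\in\mathbb R^3$ ($d_{ji}=-d_{ij}$): for $ij\in E_0$, $d_{ij}=(x_i^\star-x_j^\star)/\ell_{ij}^\star$; for $ij\in E_b$, $d_{ij}$ is arbitrary. For a triple $t=\{i<j<k\}$ put $u=d_{ij}$, $v=d_{jk}$, $w=d_{ki}$, and $h_{t,ij}=\|v\times w\|$, $h_{t,jk}=\|w\times u\|$, $h_{t,ki}=\|u\times v\|$; $t$ is nondegenerate if these are all positive. $T$ is the set of all nondegenerate triples (the retained triangles). A triple is clean if its three edges lie in $E_0$; every clean triple is assumed nondegenerate. $T_0\subset T$ is the set of clean triples. For $t\in T_0$, $s_t^\star>0$ is the number with $s_t^\star h_{t,e}=\ell_e^\star$ for all edges $e\subset t$, and $z_t^\star=\log s_t^\star$. $\mathcal C$ contains one row $f$, with a fixed orientation $(t,u)$, for each unordered pair of distinct retained triangles sharing a camera edge $e$; its residual is $r_f(z)=z_u-z_t-\log(h_{t,e}/h_{u,e})$, $z\in\mathbb R^T$. Triangle reliability scores satisfy $0\le\pi_t\le1$ and $\pi_t=1$ for $t\in T_0$; the base weight of a row joining $t,u$ is $\bar w_f=\sqrt{\pi_t\pi_u}$. $z_0$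 is the restriction of $z$ to $T_0$, and $\operatorname{err}(z_0)=\min_{\alpha\in\mathbb R}\max_{t\in T_0}|z_t-z_t^\star-\alpha|$. The clean basin at scale $\sigma$ is $\{z:\operatorname{err}(z_0)\le a\sigma\}$. $D$ is the signed incidence matrix of the rows, so that $r(z)=Dz-\mathrm{const}$. Admissible losses. $\{\rho_\sigma\}_{\sigma>0}$ is redescending MM-admissible at radius $a>0$ with constants $m_a\in(0,1]$, $K<\infty$ (independent of $\sigma$) if for every $\sigma>0$ one can write $\rho_\sigma(r)=q_\sigma(r^2)$ with $q_\sigma:[0,\infty)\to[0,\infty)$ and choose an even selector $\omega_\sigma:\mathbb R\to[0,1]$ such that: (R1) $q_\sigma$ is continuous, nondecreasing, concave, $q_\sigma(0)=0$; (R2) for all $r\in\mathbb R$, $v\ge0$: $q_\sigma(v)\le q_\sigma(r^2)+\frac12\omega_\sigma(r)(v-r^2)$; (R3) $\omega_\sigma(r)\ge m_a$ whenever $|r|\le2a\sigma$; (R4) $|\omega_\sigma(r)r|\le K\sigma$ for all $r$; (R5) $\omega_\sigma(r)r\to0$ as $|r|\to\infty$. At a kink, different admissible weight selections are permitted, and the claims hold for every sequence of selections satisfying (R2)–(R4). Exact proximal-MM orbit at scale $\sigma$ with proximal parameter $\mu_n>0$: given $z^m$, choose admissible weights $\omega_f^m=\omega_\sigma(r_f(z^m))$ and let $z^{m+1}$ be the unique minimizer over $z\in\mathbb R^T$ of $\frac12\sum_{f\in\mathcal C}\bar w_f\omega_f^mr_f(z)^2+\frac{\mu_n}2\|z-z^m\|_2^2$.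 The selected stationarity residual at $z^m$ is $g^m=D^\top s^m$ with $s_f^m=\bar w_f\omega_f^mr_f(z^m)$. *)

theory Defs
  imports "HOL-Analysis.Analysis"
begin

text \<open>
  Cameras are \<open>1, \<dots>, n\<close>. An edge of the complete graph is the pair \<open>(i, j)\<close> with
  \<open>i < j\<close>, and a triple is \<open>(i, j, k)\<close> with \<open>i < j < k\<close>.
  A vector of \<open>\<real>\<^sup>T\<close> is an element of \<open>T \<rightarrow>\<^sub>E UNIV\<close>.
\<close>

type_synonym edge = "nat \<times> nat"
type_synonym triangle = "nat \<times> nat \<times> nat"
type_synonym row = "triangle \<times> triangle"

definition K_edges :: "nat \<Rightarrow> edge set" where
  "K_edges n = {(i, j). 1 \<le> i \<and> i < j \<and> j \<le> n}"

definition K_triples :: "nat \<Rightarrow> triangle set" where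
  "K_triples n = {(i, j, k). 1 \<le> i \<and> i < j \<and> j < k \<and> k \<le> n}"

fun tri_edges :: "triangle \<Rightarrow> edge set" where
  "tri_edges (i, j, k) = {(i, j), (j, k), (i, k)}"

fun edge_len :: "(nat \<Rightarrow> real^3) \<Rightarrow> edge \<Rightarrow> real" where
  "edge_len x (i, j) = norm (x i - x j)"

text \<open>
  Genericity is read as general position in \<open>\<real>\<^sup>3\<close>: distinct cameras, no three collinear, no four
  coplanar. Locations with algebraically independent coordinates, locations outside a suitable
  proper algebraic subset, and almost all locations satisfy it.
\<close>

definition generic_locations :: "nat \<Rightarrow> (nat \<Rightarrow> real^3) \<Rightarrow> bool" where
  "generic_locations n x \<longleftrightarrow>
     inj_on x {1..n} \<and> (\<forall>S \<subseteq> {1..n}. card S \<le> 4 \<longrightarrow> \<not> affine_dependent (x ` S))"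

text \<open>
  The number \<open>h\<^bsub>t,e\<^esub>\<close> attached to an edge \<open>e\<close> of \<open>t\<close>; the last branch is the edge \<open>ki\<close>,
  stored as \<open>(i, k)\<close>. The value is only used for \<open>e \<in> tri_edges t\<close>.
\<close>

fun tri_h :: "(nat \<Rightarrow> nat \<Rightarrow> real^3) \<Rightarrow> triangle \<Rightarrow> edge \<Rightarrow> real" where
  "tri_h d (i, j, k) e =
     (let u = d i j; v = d j k; w = d k i in
      if e = (i, j) then norm (cross3 v w)
      else if e = (j, k) then norm (cross3 w u)
      else norm (cross3 u v))"

definition nondegenerate :: "(nat \<Rightarrow> nat \<Rightarrow> real^3) \<Rightarrow> triangle \<Rightarrow> bool" where
  "nondegenerate d t \<longleftrightarrow> (\<forall>e \<in> tri_edges t. 0 < tri_h d t e)"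

definition retained_triangles :: "nat \<Rightarrow> (nat \<Rightarrow> nat \<Rightarrow> real^3) \<Rightarrow> triangle set" where
  "retained_triangles n d = {t \<in> K_triples n. nondegenerate d t}"

definition clean_triples :: "nat \<Rightarrow> edge set \<Rightarrow> triangle set" where
  "clean_triples n E0 = {t \<in> K_triples n. tri_edges t \<subseteq> E0}"

definition camera_model ::
  "nat \<Rightarrow> (nat \<Rightarrow> real^3) \<Rightarrow> edge set \<Rightarrow> edge set \<Rightarrow> (nat \<Rightarrow> nat \<Rightarrow> real^3) \<Rightarrow> bool" where
  "camera_model n x E0 Eb d \<longleftrightarrow>
     generic_locations n x \<and>
     E0 \<union> Eb = K_edges n \<and> E0 \<inter> Eb = {} \<and>
     (\<forall>i \<in> {1..n}. \<forall>j \<in> {1..n}. i \<noteq> j \<longrightarrow> norm (d i j) = 1 \<and> d j i = - d i j) \<and>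
     (\<forall>(i, j) \<in> E0. d i j = (x i - x j) /\<^sub>R edge_len x (i, j)) \<and>
     (\<forall>t \<in> clean_triples n E0. nondegenerate d t)"

definition max_corruption :: "nat \<Rightarrow> edge set \<Rightarrow> nat" where
  "max_corruption n Eb = Max ((\<lambda>i. card {e \<in> Eb. fst e = i \<or> snd e = i}) ` {1..n})"

definition true_scale ::
  "(nat \<Rightarrow> real^3) \<Rightarrow> (nat \<Rightarrow> nat \<Rightarrow> real^3) \<Rightarrow> triangle \<Rightarrow> real" where
  "true_scale x d t = (THE s. 0 < s \<and> (\<forall>e \<in> tri_edges t. s * tri_h d t e = edge_len x e))"

definition true_log_scale ::
  "(nat \<Rightarrow> real^3) \<Rightarrow> (nat \<Rightarrow> nat \<Rightarrow> real^3) \<Rightarrow> triangle \<Rightarrow> real" where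
  "true_log_scale x d t = ln (true_scale x d t)"

text \<open>
  For finite nonempty \<open>T0\<close> the infimum over \<open>\<alpha>\<close> is attained, so it is the minimum.
\<close>

definition clean_err ::
  "triangle set \<Rightarrow> (triangle \<Rightarrow> real) \<Rightarrow> (triangle \<Rightarrow> real) \<Rightarrow> real" where
  "clean_err T0 zstar z = (INF \<alpha>. Max ((\<lambda>t. \<bar>z t - zstar t - \<alpha>\<bar>) ` T0))"

definition shared_edge :: "triangle \<Rightarrow> triangle \<Rightarrow> edge" where
  "shared_edge t u = the_elem (tri_edges t \<inter> tri_edges u)"

text \<open>
  A row with orientation \<open>(t, u)\<close> is the pair \<open>(t, u)\<close> itself. Distinct triangles have at most one
  common edge. The orientation is arbitrary: exactly one of \<open>(t, u)\<close> and \<open>(u, t)\<close> is chosen.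
\<close>

definition is_row_set :: "triangle set \<Rightarrow> row set \<Rightarrow> bool" where
  "is_row_set T C \<longleftrightarrow>
     (\<forall>(t, u) \<in> C. t \<in> T \<and> u \<in> T \<and> t \<noteq> u \<and> tri_edges t \<inter> tri_edges u \<noteq> {}) \<and>
     (\<forall>t \<in> T. \<forall>u \<in> T. t \<noteq> u \<and> tri_edges t \<inter> tri_edges u \<noteq> {} \<longrightarrow> ((t, u) \<in> C) \<noteq> ((u, t) \<in> C))"

fun row_residual ::
  "(nat \<Rightarrow> nat \<Rightarrow> real^3) \<Rightarrow> row \<Rightarrow> (triangle \<Rightarrow> real) \<Rightarrow> real" where
  "row_residual d (t, u) z =
     z u - z t - ln (tri_h d t (shared_edge t u) / tri_h d u (shared_edge t u))"

definition reliability_scores :: "triangle set \<Rightarrow> triangle set \<Rightarrow> (triangle \<Rightarrow> real) \<Rightarrow> bool" where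
  "reliability_scores T T0 \<pi> \<longleftrightarrow> (\<forall>t \<in> T. 0 \<le> \<pi> t \<and> \<pi> t \<le> 1) \<and> (\<forall>t \<in> T0. \<pi> t = 1)"

fun base_weight :: "(triangle \<Rightarrow> real) \<Rightarrow> row \<Rightarrow> real" where
  "base_weight \<pi> (t, u) = sqrt (\<pi> t * \<pi> u)"

fun incidence :: "row \<Rightarrow> triangle \<Rightarrow> real" where
  "incidence (t, u) s = (if s = u then 1 else if s = t then -1 else 0)"

definition MM_selector ::
  "(real \<Rightarrow> real) \<Rightarrow> real \<Rightarrow> real \<Rightarrow> real \<Rightarrow> real \<Rightarrow> (real \<Rightarrow> real) \<Rightarrow> bool" where
  "MM_selector q \<sigma> a m\<^sub>a K \<omega> \<longleftrightarrow>
     (\<forall>r. \<omega> (- r) = \<omega> r) \<and> (\<forall>r. 0 \<le> \<omega> r \<and> \<omega> r \<le> 1) \<and>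
     (\<forall>r. \<forall>v \<ge> 0. q v \<le> q (r\<^sup>2) + 1/2 * \<omega> r * (v - r\<^sup>2)) \<and>
     (\<forall>r. \<bar>r\<bar> \<le> 2 * a * \<sigma> \<longrightarrow> m\<^sub>a \<le> \<omega> r) \<and>
     (\<forall>r. \<bar>\<omega> r * r\<bar> \<le> K * \<sigma>)"

definition redescending_MM_admissible ::
  "(real \<Rightarrow> real \<Rightarrow> real) \<Rightarrow> real \<Rightarrow> real \<Rightarrow> real \<Rightarrow> bool" where
  "redescending_MM_admissible \<rho> a m\<^sub>a K \<longleftrightarrow>
     (\<forall>\<sigma> > 0. \<exists>q \<omega>.
        (\<forall>r. \<rho> \<sigma> r = q (r\<^sup>2)) \<and>
        continuous_on {0..} q \<and> mono_on {0..} q \<and> concave_on {0..} q \<and>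
        q 0 = 0 \<and> (\<forall>v \<ge> 0. 0 \<le> q v) \<and>
        MM_selector q \<sigma> a m\<^sub>a K \<omega> \<and>
        ((\<lambda>r. \<omega> r * r) \<longlongrightarrow> 0) at_infinity)"

text \<open>
  The selections an orbit may use: they need not satisfy the decay of \<open>\<omega> r * r\<close> at infinity.
  The profile \<open>q\<close> is determined on \<open>{0..}\<close> by the loss, and only those values matter.
\<close>

definition admissible_selection ::
  "(real \<Rightarrow> real) \<Rightarrow> real \<Rightarrow> real \<Rightarrow> real \<Rightarrow> real \<Rightarrow> (real \<Rightarrow> real) \<Rightarrow> bool" where
  "admissible_selection \<rho> \<sigma> a m\<^sub>a K \<omega> \<longleftrightarrow>
     (\<exists>q. (\<forall>r. \<rho> r = q (r\<^sup>2)) \<and> MM_selector q \<sigma> a m\<^sub>a K \<omega>)"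

definition LS_objective ::
  "(nat \<Rightarrow> nat \<Rightarrow> real^3) \<Rightarrow> (triangle \<Rightarrow> real) \<Rightarrow> row set \<Rightarrow> (triangle \<Rightarrow> real) \<Rightarrow> real" where
  "LS_objective d \<pi> C z = 1/2 * (\<Sum>f\<in>C. base_weight \<pi> f * (row_residual d f z)\<^sup>2)"

definition LS_max_residual ::
  "(nat \<Rightarrow> nat \<Rightarrow> real^3) \<Rightarrow> (triangle \<Rightarrow> real) \<Rightarrow> row set \<Rightarrow> (triangle \<Rightarrow> real) \<Rightarrow> real" where
  "LS_max_residual d \<pi> C z = Max {\<bar>row_residual d f z\<bar> | f. f \<in> C \<and> 0 < base_weight \<pi> f}"

definition prox_objective ::
  "(nat \<Rightarrow> nat \<Rightarrow> real^3) \<Rightarrow> (triangle \<Rightarrow> real) \<Rightarrow> triangle set \<Rightarrow> row set \<Rightarrow> real \<Rightarrow>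
   (row \<Rightarrow> real) \<Rightarrow> (triangle \<Rightarrow> real) \<Rightarrow> (triangle \<Rightarrow> real) \<Rightarrow> real" where
  "prox_objective d \<pi> T C \<mu> wt z z' =
     1/2 * (\<Sum>f\<in>C. base_weight \<pi> f * wt f * (row_residual d f z')\<^sup>2)
     + \<mu> / 2 * (\<Sum>t\<in>T. (z' t - z t)\<^sup>2)"

text \<open>
  The selection \<open>\<omega> m f\<close> may change with the iteration and with the row, so different
  selections at a kink are allowed. For \<open>\<mu> > 0\<close> the objective is strongly convex on \<open>\<real>\<^sup>T\<close>, so the
  minimizer below is unique.
\<close>

definition prox_MM_orbit ::
  "(real \<Rightarrow> real) \<Rightarrow> real \<Rightarrow> real \<Rightarrow> real \<Rightarrow> real \<Rightarrow> real \<Rightarrow> (nat \<Rightarrow> nat \<Rightarrow> real^3) \<Rightarrow>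
   (triangle \<Rightarrow> real) \<Rightarrow> triangle set \<Rightarrow> row set \<Rightarrow>
   (nat \<Rightarrow> row \<Rightarrow> real \<Rightarrow> real) \<Rightarrow> (nat \<Rightarrow> triangle \<Rightarrow> real) \<Rightarrow> bool" where
  "prox_MM_orbit \<rho> \<sigma> a m\<^sub>a K \<mu> d \<pi> T C \<omega> z \<longleftrightarrow>
     z 0 \<in> T \<rightarrow>\<^sub>E UNIV \<and>
     (\<forall>m. \<forall>f \<in> C. admissible_selection \<rho> \<sigma> a m\<^sub>a K (\<omega> m f)) \<and>
     (\<forall>m. is_arg_min
            (prox_objective d \<pi> T C \<mu> (\<lambda>f. \<omega> m f (row_residual d f (z m))) (z m))
            (\<lambda>y. y \<in> T \<rightarrow>\<^sub>E UNIV) (z (Suc m)))"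

definition stationarity_residual ::
  "(nat \<Rightarrow> nat \<Rightarrow> real^3) \<Rightarrow> (triangle \<Rightarrow> real) \<Rightarrow> row set \<Rightarrow>
   (row \<Rightarrow> real \<Rightarrow> real) \<Rightarrow> (triangle \<Rightarrow> real) \<Rightarrow> triangle \<Rightarrow> real" where
  "stationarity_residual d \<pi> C \<omega> z t =
     (\<Sum>f\<in>C. incidence f t *
        (base_weight \<pi> f * \<omega> f (row_residual d f z) * row_residual d f z))"

definition sup_norm :: "triangle set \<Rightarrow> (triangle \<Rightarrow> real) \<Rightarrow> real" where
  "sup_norm T g = Max ((\<lambda>t. \<bar>g t\<bar>) ` T)"

definition admissible_schedule :: "real \<Rightarrow> (nat \<Rightarrow> real) \<Rightarrow> bool" where
  "admissible_schedule L \<sigma> \<longleftrightarrow>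
     decseq \<sigma> \<and> (\<forall>k. 0 < \<sigma> k) \<and> \<sigma> \<longlonglongrightarrow> 0 \<and>
     (\<forall>k. L < \<sigma> (Suc k) / \<sigma> k \<and> \<sigma> (Suc k) / \<sigma> k < 1)"

text \<open>
  \<open>reached k m\<close> says that the stopping rule of scale \<open>k\<close> holds at inner index \<open>m\<close>. A stopping index
  \<open>stop k\<close> is any index at which the rule holds, provided that there is one. That the rule is
  ever reached is not assumed here; if it were not, \<open>stop k\<close> would be unconstrained.
\<close>

definition stopping_indices :: "(nat \<Rightarrow> nat \<Rightarrow> bool) \<Rightarrow> (nat \<Rightarrow> nat) \<Rightarrow> bool" where
  "stopping_indices reached stop \<longleftrightarrow> (\<forall>k. (\<exists>m. reached k m) \<longrightarrow> reached k (stop k))"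

definition warm_started ::
  "(triangle \<Rightarrow> real) \<Rightarrow> (nat \<Rightarrow> nat) \<Rightarrow> (nat \<Rightarrow> nat \<Rightarrow> triangle \<Rightarrow> real) \<Rightarrow> bool" where
  "warm_started zLS stop z \<longleftrightarrow> z 0 0 = zLS \<and> (\<forall>k. z (Suc k) 0 = z k (stop k))"

end

theory Submission
  imports Defs
begin

text \<open>
  Adding the Laplacian equations of the clean triangle graph over the triangles at an edge, and then
  at a camera, expresses every potential through the flows up to relative errors of order
  \<open>\<Delta>\<^sub>E / n\<close>. This gives the Green bound: the half-range of a potential is at most \<open>G\<^sub>J / n\<close> times the
  distance of its Laplacian from the constants. Weights in \<open>[m\<^sub>a, 1]\<close> perturb the Laplacian by at most
  \<open>6 n (1 - m\<^sub>a)\<close> half-ranges, so the constant becomes \<open>G\<^sub>a\<close>.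

  A clean triangle meets at most \<open>6 c n\<close> corrupted rows, each with force at most \<open>K \<sigma>\<close>, so the
  Green bound localises stationary points. For a proximal step the maximum principle bounds the
  displacement of all triangles by \<open>3 K \<sigma> / \<kappa>\<^sub>a\<close>, hence the corrupted forces after the step; since
  \<open>\<mu> G\<^sub>a / n = 1/4\<close>, the Green bound turns the step equation into \<open>3/4 b' \<le> 1/4 b + (\<dots>)\<close> for the
  half-ranges \<open>b\<close>, \<open>b'\<close> before and after the step. Majorisation makes the objective
  decrease, so the steps, and with them the stationarity residuals, come arbitrarily close to 0. At the
  least-squares start, any two clean triangles are joined by five adjacent pairs of clean triangles.
\<close>


subsection \<open>Potentials on the triangles of a dense graph\<close>

text \<open>The obstacle is the proximal step. Its weights are frozen at the old iterate, so the
  bound \<open>K * s\<close> on a corrupted force holds before the step only; afterwards the force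
  also contains the displacements of both ends. The Green bound does not reach triangles outside
  \<open>T0\<close>; the maximum principle does, since it asks only for nonnegative weights and
  bounded old fluxes. A clean end is controlled through the extremal triangles of the new iterate,
  and this estimate refers back to the corrupted forces. The smallness condition on \<open>c\<close>
  closes the loop.

  Half-ranges are the natural size throughout: \<open>clean_err\<close> is the half-range of the
  deviation from the truth, and half-ranges ignore the additive gauge. The Green bound accordingly
  tolerates an arbitrary constant \<open>\<beta>\<close> in the Laplacian, which in the proximal
  step absorbs the drift of the centre.\<close>

locale dense_graph =
  fixes V :: "'a set" and e :: "'a \<Rightarrow> 'a \<Rightarrow> real" and D :: real
  assumes finite_V: "finite V" and V_nonempty: "V \<noteq> {}"
    and e_cases: "\<And>i j. e i j = 0 \<or> e i j = 1"
    and e_sym: "\<And>i j. e i j = e j i"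
    and defect: "\<And>i. i \<in> V \<Longrightarrow> (\<Sum>j\<in>V. 1 - e i j) \<le> D"
begin

abbreviation card_V :: real where
  "card_V \<equiv> real (card V)"

lemma card_V_pos: "0 < card_V"
  using finite_V V_nonempty by (simp add: card_gt_0_iff)

definition tri :: "'a \<Rightarrow> 'a \<Rightarrow> 'a \<Rightarrow> real" where
  "tri i j k = e i j * e j k * e i k"

definition codeg :: "'a \<Rightarrow> 'a \<Rightarrow> real" where
  "codeg i j = (\<Sum>a\<in>V. tri i j a)"

lemma e_bounds: "0 \<le> e i j" "e i j \<le> 1"
  using e_cases[of i j] by auto

lemma tri_cases: "tri i j k = 0 \<or> tri i j k = 1"
  unfolding tri_def using e_cases[of i j] e_cases[of j k] e_cases[of i k] by auto

lemma tri_swap12: "tri i j k = tri j i k"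
  by (simp add: tri_def e_sym mult_ac)

lemma tri_swap23: "tri i j k = tri i k j"
  using e_sym[of k j] by (simp add: tri_def mult_ac)

lemma defect_nonneg: "0 \<le> D"
proof -
  obtain i where "i \<in> V" using V_nonempty by blast
  have "0 \<le> (\<Sum>j\<in>V. 1 - e i j)" by (intro sum_nonneg) (simp add: e_bounds)
  also have "\<dots> \<le> D" using \<open>i \<in> V\<close> by (rule defect)
  finally show ?thesis .
qed

text \<open>A third vertex fails only if its edge to \<open>i\<close> or its edge to
  \<open>j\<close> is missing, so the two defects add up.\<close>

lemma codeg_approx:
  assumes "i \<in> V" "j \<in> V" "e i j = 1"
  shows "\<bar>codeg i j - card_V\<bar> \<le> 2 * D"
proof -
  have "card_V - codeg i j = (\<Sum>a\<in>V. 1 - tri i j a)"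
    by (simp add: codeg_def sum_subtractf)
  moreover have "(\<Sum>a\<in>V. 1 - tri i j a) \<le> (\<Sum>a\<in>V. (1 - e i a) + (1 - e j a))"
  proof (intro sum_mono)
    fix a show "1 - tri i j a \<le> (1 - e i a) + (1 - e j a)"
      using assms(3) e_cases[of i a] e_cases[of j a] by (auto simp: tri_def)
  qed
  moreover have "(\<Sum>a\<in>V. (1 - e i a) + (1 - e j a)) \<le> D + D"
    unfolding sum.distrib using defect assms by (intro add_mono) auto
  moreover have "0 \<le> (\<Sum>a\<in>V. 1 - tri i j a)"
  proof (intro sum_nonneg)
    fix a show "0 \<le> 1 - tri i j a" using tri_cases[of i j a] by auto
  qed
  ultimately show ?thesis by simp
qed

text \<open>Double counting: if every vertex missed some member of \<open>A\<close>, there would be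
  at least \<open>card V\<close> missing pairs, while each member of \<open>A\<close> accounts for
  at most \<open>D\<close> of them.\<close>

lemma common_neighbour:
  assumes "finite A" "A \<subseteq> V" "real (card A) * D < card_V"
  obtains p where "p \<in> V" "\<forall>a\<in>A. e a p = 1"
proof (rule ccontr)
  assume "\<not> thesis"
  with that have bad: "\<exists>a\<in>A. e a p = 0" if "p \<in> V" for p
    using e_cases \<open>p \<in> V\<close> by metis
  have "card_V = (\<Sum>p\<in>V. 1)" by simp
  also have "\<dots> \<le> (\<Sum>p\<in>V. \<Sum>a\<in>A. 1 - e a p)"
  proof (intro sum_mono)
    fix p assume "p \<in> V"
    then obtain a where a: "a \<in> A" "e a p = 0" using bad by blast
    then have "1 \<le> 1 - e a p" by simp
    also have "\<dots> \<le> (\<Sum>a\<in>A. 1 - e a p)"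
      using a assms(1) by (intro member_le_sum) (auto simp: e_bounds)
    finally show "1 \<le> (\<Sum>a\<in>A. 1 - e a p)" .
  qed
  also have "\<dots> = (\<Sum>a\<in>A. \<Sum>p\<in>V. 1 - e a p)" by (rule sum.swap)
  also have "\<dots> \<le> (\<Sum>a\<in>A. D)" using assms(2) by (intro sum_mono defect) auto
  finally show False using assms(3) by simp
qed

end

section \<open>Approximate inversion of the triangle Laplacian\<close>

locale triple_potential = dense_graph V e D
  for V :: "'a set" and e :: "'a \<Rightarrow> 'a \<Rightarrow> real" and D :: real +
  fixes Y :: "'a \<Rightarrow> 'a \<Rightarrow> 'a \<Rightarrow> real" and b :: real
  assumes Y_swap12: "\<And>i j k. Y i j k = Y j i k"
    and Y_swap23: "\<And>i j k. Y i j k = Y i k j"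
    and Y_supp: "\<And>i j k. tri i j k * Y i j k = Y i j k"
    and Y_bound: "\<And>i j k. \<bar>Y i j k\<bar> \<le> b"
begin

definition edge_sum :: "'a \<Rightarrow> 'a \<Rightarrow> real" where
  "edge_sum i j = (\<Sum>a\<in>V. Y i j a)"

definition vertex_sum :: "'a \<Rightarrow> real" where
  "vertex_sum i = (\<Sum>a\<in>V. edge_sum i a)"

text \<open>The potential is extended by zero to all ordered triples, so no sum carries an order
  condition. A triangle with distinct corners counts once in \<open>edge_sum\<close>, twice in
  \<open>vertex_sum\<close> and six times here.\<close>

definition total_sum :: real where
  "total_sum = (\<Sum>i\<in>V. vertex_sum i)"

text \<open>On a triangle this is \<open>\<Sum>a\<in>V. tri i j a * (Y i j k - Y i j a)\<close> with
  the sum carried out: the part of the Laplacian that passes through the edge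
  \<open>i j\<close>.\<close>

definition edge_flow :: "'a \<Rightarrow> 'a \<Rightarrow> 'a \<Rightarrow> real" where
  "edge_flow i j k = tri i j k * (codeg i j * Y i j k - edge_sum i j)"

text \<open>Triangles with a common edge are adjacent, so the triangles on an edge form a clique, and the
  Laplacian is a sum over the three edges.\<close>

definition laplacian :: "'a \<Rightarrow> 'a \<Rightarrow> 'a \<Rightarrow> real" where
  "laplacian i j k = edge_flow i j k + edge_flow j k i + edge_flow k i j"

lemma b_nonneg: "0 \<le> b" using Y_bound[of undefined undefined undefined] by simp

lemma edge_sum_sym: "edge_sum i j = edge_sum j i"
  by (simp add: edge_sum_def Y_swap12[of i])

lemma codeg_sym: "codeg i j = codeg j i"
  by (simp add: codeg_def tri_swap12[of i])

lemma Y_e: "e i j * Y i j k = Y i j k"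
  using Y_supp[of i j k] e_cases[of i j] by (auto simp: tri_def)

lemma edge_sum_e: "e i j * edge_sum i j = edge_sum i j"
  by (simp add: edge_sum_def sum_distrib_left Y_e)

lemma edge_sum_bound: "\<bar>edge_sum i j\<bar> \<le> card_V * b"
proof -
  have "\<bar>edge_sum i j\<bar> \<le> (\<Sum>a\<in>V. \<bar>Y i j a\<bar>)" unfolding edge_sum_def by (rule sum_abs)
  also have "\<dots> \<le> (\<Sum>a\<in>V. b)" by (intro sum_mono Y_bound)
  finally show ?thesis by simp
qed

lemma edge_flow_swap: "edge_flow i j k = edge_flow j i k"
  by (simp add: edge_flow_def tri_swap12[of i] codeg_sym[of i] edge_sum_sym[of i] Y_swap12[of i])

text \<open>Differences inside a clique are antisymmetric and cancel. Summing the Laplacian over a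
  vertex thereby removes the edge opposite to it.\<close>

lemma sum_edge_flow: "(\<Sum>a\<in>V. edge_flow i j a) = 0"
proof -
  have "(\<Sum>a\<in>V. edge_flow i j a) = (\<Sum>a\<in>V. codeg i j * (tri i j a * Y i j a) - edge_sum i j * tri i j a)"
    by (simp add: edge_flow_def algebra_simps)
  also have "\<dots> = codeg i j * edge_sum i j - edge_sum i j * codeg i j"
    by (simp add: sum_subtractf sum_distrib_left[symmetric] codeg_def edge_sum_def Y_supp)
  finally show ?thesis by simp
qed

text \<open>Replacing \<open>codeg\<close> by \<open>card_V\<close> costs \<open>2 * D * b\<close>.
  Dropping the factor \<open>tri\<close> costs a full \<open>card_V * b\<close>, but only if
  \<open>k\<close> is not joined to both ends. That cost is kept as an indicator because it becomes
  small only after summation.\<close>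

lemma edge_flow_error:
  assumes "i \<in> V" "j \<in> V"
  shows "\<bar>edge_flow i j k - (card_V * Y i j k - edge_sum i j)\<bar>
           \<le> 2 * D * b + ((1 - e i k) + (1 - e j k)) * (card_V * b)"
proof -
  have "edge_flow i j k - (card_V * Y i j k - edge_sum i j) =
      codeg i j * (tri i j k * Y i j k) - card_V * Y i j k + (1 - tri i j k) * edge_sum i j"
    by (simp add: edge_flow_def algebra_simps)
  also have "\<dots> = (codeg i j - card_V) * Y i j k + (1 - tri i j k) * edge_sum i j"
    unfolding Y_supp by (simp add: algebra_simps)
  finally have eq: "edge_flow i j k - (card_V * Y i j k - edge_sum i j) =
      (codeg i j - card_V) * Y i j k + (1 - tri i j k) * edge_sum i j" .
  show ?thesis
  proof (cases "e i j = 1")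
    case True
    have "\<bar>(codeg i j - card_V) * Y i j k\<bar> \<le> 2 * D * b"
      unfolding abs_mult using codeg_approx[OF assms True] Y_bound[of i j k]
      by (intro mult_mono) auto
    moreover have "\<bar>(1 - tri i j k) * edge_sum i j\<bar> \<le> ((1 - e i k) + (1 - e j k)) * (card_V * b)"
      unfolding abs_mult
    proof (intro mult_mono edge_sum_bound)
      show "\<bar>1 - tri i j k\<bar> \<le> (1 - e i k) + (1 - e j k)"
        using True e_cases[of i k] e_cases[of j k] by (auto simp: tri_def)
    qed (use e_bounds[of i k] e_bounds[of j k] in auto)
    ultimately show ?thesis unfolding eq by linarith
  next
    case False
    then have "e i j = 0" using e_cases by blast
    then have "Y i j k = 0" "edge_sum i j = 0" using Y_e[of i j k] edge_sum_e[of i j] by auto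
    then show ?thesis unfolding eq
      using b_nonneg defect_nonneg e_bounds[of i k] e_bounds[of j k] card_V_pos by simp
  qed
qed

text \<open>Since \<open>i j\<close> is an edge, one of the two indicators vanishes; the factor
  \<open>3\<close> is \<open>2 + 1\<close>.\<close>

lemma edge_flow_error_sum:
  assumes "i \<in> V" "j \<in> V" "e i j = 1"
  shows "\<bar>(\<Sum>a\<in>V. edge_flow i a j) - (card_V * edge_sum i j - vertex_sum i)\<bar> \<le> 3 * D * card_V * b"
proof -
  have eq: "(\<Sum>a\<in>V. edge_flow i a j) - (card_V * edge_sum i j - vertex_sum i)
      = (\<Sum>a\<in>V. edge_flow i a j - (card_V * Y i a j - edge_sum i a))"
    unfolding sum_subtractf sum_distrib_left[symmetric] edge_sum_def[of i j] vertex_sum_def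
    unfolding Y_swap23[of i _ j, symmetric] by (rule refl)
  have "\<bar>(\<Sum>a\<in>V. edge_flow i a j) - (card_V * edge_sum i j - vertex_sum i)\<bar>
      \<le> (\<Sum>a\<in>V. \<bar>edge_flow i a j - (card_V * Y i a j - edge_sum i a)\<bar>)"
    unfolding eq by (rule sum_abs)
  also have "\<dots> \<le> (\<Sum>a\<in>V. 2 * D * b + (1 - e j a) * (card_V * b))"
  proof (intro sum_mono)
    fix a assume "a \<in> V"
    then show "\<bar>edge_flow i a j - (card_V * Y i a j - edge_sum i a)\<bar>
        \<le> 2 * D * b + (1 - e j a) * (card_V * b)"
      using edge_flow_error[OF assms(1) \<open>a \<in> V\<close>, of j] unfolding assms(3) e_sym[of a j] by simp
  qed
  also have "\<dots> = 2 * D * b * card_V + (\<Sum>a\<in>V. 1 - e j a) * (card_V * b)"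
    unfolding sum.distrib sum_distrib_right[symmetric] sum_constant by algebra
  also have "\<dots> \<le> 2 * D * b * card_V + D * (card_V * b)"
    using defect[OF assms(2)] b_nonneg card_V_pos by (intro add_left_mono mult_right_mono) simp_all
  also have "\<dots> = 3 * D * card_V * b" by algebra
  finally show ?thesis .
qed

text \<open>Summed over the third vertex, the flow through \<open>i j\<close> cancels. The flows
  through the edges at \<open>i\<close> and at \<open>j\<close> remain, and
  \<open>edge_flow_error_sum\<close> evaluates each of them.\<close>

lemma edge_sum_approx:
  assumes "i \<in> V" "j \<in> V" "e i j = 1"
    and "\<And>k. k \<in> V \<Longrightarrow> \<bar>laplacian i j k\<bar> \<le> \<gamma>"
  shows "\<bar>2 * card_V * edge_sum i j - vertex_sum i - vertex_sum j\<bar> \<le> card_V * \<gamma> + 6 * D * card_V * b"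
proof -
  have "(\<Sum>k\<in>V. laplacian i j k) = (\<Sum>k\<in>V. edge_flow j k i) + (\<Sum>k\<in>V. edge_flow i k j)"
    using edge_flow_swap[of i _ j] by (simp add: laplacian_def sum.distrib sum_edge_flow)
  moreover have "\<bar>\<Sum>k\<in>V. laplacian i j k\<bar> \<le> card_V * \<gamma>"
  proof -
    have "\<bar>\<Sum>k\<in>V. laplacian i j k\<bar> \<le> (\<Sum>k\<in>V. \<bar>laplacian i j k\<bar>)" by (rule sum_abs)
    also have "\<dots> \<le> (\<Sum>k\<in>V. \<gamma>)" by (intro sum_mono assms(4))
    finally show ?thesis by simp
  qed
  moreover have "e j i = 1" using assms(3) e_sym[of i j] by simp
  then have "\<bar>(\<Sum>k\<in>V. edge_flow j k i) - (card_V * edge_sum i j - vertex_sum j)\<bar> \<le> 3 * D * card_V * b"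
    using edge_flow_error_sum[OF assms(2,1)] edge_sum_sym[of i j] by simp
  ultimately show ?thesis
    using edge_flow_error_sum[OF assms(1-3)] by linarith
qed

text \<open>Summed over all \<open>j\<close> and \<open>k\<close>, the flows through both edges at
  \<open>i\<close> cancel and only the flow through the opposite edge survives. Both indicators
  remain, so the factor \<open>4\<close> is \<open>2 + 1 + 1\<close>.\<close>

lemma vertex_sum_approx:
  assumes "i \<in> V"
    and "\<And>j k. j \<in> V \<Longrightarrow> k \<in> V \<Longrightarrow> \<bar>laplacian i j k\<bar> \<le> \<gamma>"
  shows "\<bar>card_V * vertex_sum i - total_sum\<bar> \<le> card_V\<^sup>2 * \<gamma> + 4 * D * card_V\<^sup>2 * b"
proof -
  have "(\<Sum>j\<in>V. \<Sum>k\<in>V. edge_flow k i j) = (\<Sum>k\<in>V. \<Sum>j\<in>V. edge_flow k i j)"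
    by (rule sum.swap)
  then have lap: "(\<Sum>j\<in>V. \<Sum>k\<in>V. laplacian i j k) = (\<Sum>j\<in>V. \<Sum>k\<in>V. edge_flow j k i)"
    by (simp add: laplacian_def sum.distrib sum_edge_flow)
  have "\<bar>\<Sum>j\<in>V. \<Sum>k\<in>V. laplacian i j k\<bar> \<le> (\<Sum>j\<in>V. \<bar>\<Sum>k\<in>V. laplacian i j k\<bar>)"
    by (rule sum_abs)
  also have "\<dots> \<le> (\<Sum>j\<in>V. \<Sum>k\<in>V. \<bar>laplacian i j k\<bar>)"
    by (intro sum_mono sum_abs)
  also have "\<dots> \<le> (\<Sum>j\<in>V. \<Sum>k\<in>V. \<gamma>)" by (intro sum_mono assms(2))
  finally have 1: "\<bar>\<Sum>j\<in>V. \<Sum>k\<in>V. edge_flow j k i\<bar> \<le> card_V\<^sup>2 * \<gamma>"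
    unfolding lap by (simp add: power2_eq_square mult_ac)
  have vs: "vertex_sum i = (\<Sum>j\<in>V. \<Sum>k\<in>V. Y j k i)"
    unfolding vertex_sum_def edge_sum_def by (intro sum.cong refl) (simp add: Y_swap12[of i] Y_swap23[of _ i])
  have eq: "(\<Sum>j\<in>V. \<Sum>k\<in>V. edge_flow j k i) - (card_V * vertex_sum i - total_sum)
      = (\<Sum>j\<in>V. \<Sum>k\<in>V. edge_flow j k i - (card_V * Y j k i - edge_sum j k))"
    unfolding sum_subtractf sum_distrib_left[symmetric] vs total_sum_def vertex_sum_def[symmetric] by simp
  have "\<bar>(\<Sum>j\<in>V. \<Sum>k\<in>V. edge_flow j k i) - (card_V * vertex_sum i - total_sum)\<bar>
      \<le> (\<Sum>j\<in>V. \<bar>\<Sum>k\<in>V. edge_flow j k i - (card_V * Y j k i - edge_sum j k)\<bar>)"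
    unfolding eq by (rule sum_abs)
  also have "\<dots> \<le> (\<Sum>j\<in>V. \<Sum>k\<in>V. \<bar>edge_flow j k i - (card_V * Y j k i - edge_sum j k)\<bar>)"
    by (intro sum_mono sum_abs)
  also have "\<dots> \<le> (\<Sum>j\<in>V. \<Sum>k\<in>V. 2 * D * b + ((1 - e i j) + (1 - e i k)) * (card_V * b))"
    using edge_flow_error[of _ _ i] e_sym[of _ i] by (intro sum_mono) simp
  also have "\<dots> = (\<Sum>j\<in>V. card_V * (2 * D * b + (1 - e i j) * (card_V * b)) + (\<Sum>k\<in>V. 1 - e i k) * (card_V * b))"
  proof (rule sum.cong[OF refl])
    fix j assume "j \<in> V"
    have "(\<Sum>k\<in>V. 2 * D * b + ((1 - e i j) + (1 - e i k)) * (card_V * b))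
        = (\<Sum>k\<in>V. (2 * D * b + (1 - e i j) * (card_V * b)) + (1 - e i k) * (card_V * b))"
      by (simp only: distrib_right add.assoc)
    then show "(\<Sum>k\<in>V. 2 * D * b + ((1 - e i j) + (1 - e i k)) * (card_V * b))
        = card_V * (2 * D * b + (1 - e i j) * (card_V * b)) + (\<Sum>k\<in>V. 1 - e i k) * (card_V * b)"
      by (simp only: sum.distrib[of "\<lambda>k. 2 * D * b + (1 - e i j) * (card_V * b)"] sum_distrib_right sum_constant)
  qed
  also have "\<dots> = card_V * (card_V * (2 * D * b) + (\<Sum>j\<in>V. 1 - e i j) * (card_V * b)) + card_V * ((\<Sum>k\<in>V. 1 - e i k) * (card_V * b))"
    by (simp only: sum.distrib sum_distrib_left[symmetric] sum_distrib_right[symmetric] sum_constant) algebra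
  also have "\<dots> = 2 * D * b * card_V\<^sup>2 + (\<Sum>j\<in>V. 1 - e i j) * (card_V\<^sup>2 * b) + (\<Sum>k\<in>V. 1 - e i k) * (card_V\<^sup>2 * b)"
    by algebra
  also have "\<dots> \<le> 2 * D * b * card_V\<^sup>2 + D * (card_V\<^sup>2 * b) + D * (card_V\<^sup>2 * b)"
    using defect[OF assms(1)] b_nonneg by (intro add_mono order_refl mult_right_mono) auto
  also have "\<dots> = 4 * D * card_V\<^sup>2 * b" by algebra
  finally show ?thesis using 1 by linarith
qed

text \<open>\<open>11/6 = 1/3 + 1/2 + 1\<close>: the flow at the triangle, at its three edges and at its three
  cameras contributes these multiples of \<open>\<gamma> / n\<close>.\<close>

lemma potential_approx:
  assumes lap: "\<And>i j k. i \<in> V \<Longrightarrow> j \<in> V \<Longrightarrow> k \<in> V \<Longrightarrow> \<bar>laplacian i j k\<bar> \<le> \<gamma>"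
    and ijk: "i \<in> V" "j \<in> V" "k \<in> V" "tri i j k = 1"
  shows "\<bar>card_V ^ 3 * Y i j k - total_sum\<bar> \<le> card_V\<^sup>2 * (11 / 6 * \<gamma> + 9 * D * b)"
proof -
  define N where "N = card_V"
  have N: "0 < N" using card_V_pos by (simp add: N_def)
  have es: "e i j = 1" "e j k = 1" "e k i = 1" "e j i = 1" "e k j = 1" "e i k = 1"
    using ijk(4) e_cases[of i j] e_cases[of j k] e_cases[of i k]
    by (auto simp: tri_def e_sym[of j i] e_sym[of k i] e_sym[of k j])
  \<comment> \<open>One edge estimate and two vertex estimates, halved:
    \<open>3/2 = (1 + 1 + 1) / 2\<close> and \<open>7 = (6 + 4 + 4) / 2\<close>.\<close>
  have E: "\<bar>N\<^sup>2 * edge_sum l m - total_sum\<bar> \<le> N\<^sup>2 * (3 / 2 * \<gamma> + 7 * D * b)"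
    if lm: "l \<in> V" "m \<in> V" "e l m = 1" for l m
  proof -
    define u where "u = N * (2 * N * edge_sum l m - vertex_sum l - vertex_sum m)"
    define g d where "g = N\<^sup>2 * \<gamma>" and "d = N\<^sup>2 * (D * b)"
    have "2 * (N\<^sup>2 * edge_sum l m - total_sum)
        = u + (N * vertex_sum l - total_sum) + (N * vertex_sum m - total_sum)"
      by (simp add: u_def algebra_simps power2_eq_square)
    moreover have "\<bar>u\<bar> \<le> N * (N * \<gamma> + 6 * D * N * b)"
      using edge_sum_approx[OF lm lap[OF lm(1,2)]] N
      unfolding u_def abs_mult N_def[symmetric] by (intro mult_mono) auto
    then have "\<bar>u\<bar> \<le> g + 6 * d"
      by (simp add: g_def d_def algebra_simps power2_eq_square)
    moreover have "\<bar>N * vertex_sum l' - total_sum\<bar> \<le> g + 4 * d" if "l' \<in> V" for l'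
      using vertex_sum_approx[OF that lap[OF that]] by (simp add: N_def g_def d_def mult_ac)
    note this[OF lm(1)] this[OF lm(2)]
    ultimately have "2 * \<bar>N\<^sup>2 * edge_sum l m - total_sum\<bar> \<le> 3 * g + 14 * d"
      by linarith
    then show ?thesis by (simp add: g_def d_def algebra_simps)
  qed
  have perm: "Y j k i = Y i j k" "Y k i j = Y i j k"
    by (simp_all only: Y_swap23[of j k i] Y_swap12[of j i k] Y_swap12[of k i j] Y_swap23[of i k j])
  have F: "\<bar>edge_flow i j k - (N * Y i j k - edge_sum i j)\<bar> \<le> 2 * D * b"
    "\<bar>edge_flow j k i - (N * Y i j k - edge_sum j k)\<bar> \<le> 2 * D * b"
    "\<bar>edge_flow k i j - (N * Y i j k - edge_sum k i)\<bar> \<le> 2 * D * b"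
    using edge_flow_error[OF ijk(1,2), of k] edge_flow_error[OF ijk(2,3), of i]
      edge_flow_error[OF ijk(3,1), of j] unfolding N_def es perm by simp_all
  define y1 y2 y3 where "y1 = edge_sum i j" and "y2 = edge_sum j k" and "y3 = edge_sum k i"
  have 1: "\<bar>3 * N * Y i j k - (y1 + y2 + y3)\<bar> \<le> \<gamma> + 6 * D * b"
    using F lap[OF ijk(1-3)] unfolding laplacian_def y1_def y2_def y3_def abs_le_iff by linarith
  have 2: "\<bar>N\<^sup>2 * y1 - total_sum\<bar> \<le> N\<^sup>2 * (3 / 2 * \<gamma> + 7 * D * b)"
    "\<bar>N\<^sup>2 * y2 - total_sum\<bar> \<le> N\<^sup>2 * (3 / 2 * \<gamma> + 7 * D * b)"
    "\<bar>N\<^sup>2 * y3 - total_sum\<bar> \<le> N\<^sup>2 * (3 / 2 * \<gamma> + 7 * D * b)"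
    unfolding y1_def y2_def y3_def by (intro E ijk es)+
  define u where "u = N\<^sup>2 * (3 * N * Y i j k - (y1 + y2 + y3))"
  define g d where "g = N\<^sup>2 * \<gamma>" and "d = N\<^sup>2 * (D * b)"
  have "3 * (N ^ 3 * Y i j k - total_sum) = u
      + (N\<^sup>2 * y1 - total_sum) + (N\<^sup>2 * y2 - total_sum) + (N\<^sup>2 * y3 - total_sum)"
    unfolding u_def by algebra
  moreover have "\<bar>u\<bar> \<le> N\<^sup>2 * (\<gamma> + 6 * D * b)"
    using 1 unfolding u_def abs_mult by (intro mult_mono) auto
  then have "\<bar>u\<bar> \<le> g + 6 * d" by (simp add: g_def d_def algebra_simps)
  moreover have "N\<^sup>2 * (3 / 2 * \<gamma> + 7 * D * b) = 3 / 2 * g + 7 * d"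
    by (simp add: g_def d_def algebra_simps)
  note 2[unfolded this]
  \<comment> \<open>Here \<open>11/2 = 1 + 3 * 3/2\<close> and
    \<open>27 = 6 + 3 * 7\<close>.\<close>
  ultimately have "3 * \<bar>N ^ 3 * Y i j k - total_sum\<bar> \<le> 11 / 2 * g + 27 * d"
    unfolding abs_le_iff by linarith
  then have "\<bar>N ^ 3 * Y i j k - total_sum\<bar> \<le> N\<^sup>2 * (11 / 6 * \<gamma> + 9 * D * b)"
    by (simp add: g_def d_def algebra_simps)
  then show ?thesis by (simp add: N_def)
qed

end

subsection \<open>Sorted triples and shared edges\<close>

definition sort_pair :: "nat \<Rightarrow> nat \<Rightarrow> edge" where
  "sort_pair i j = (min i j, max i j)"

text \<open>The middle entry is the median. Triangles are stored sorted while the potential must be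
  symmetric in its arguments; sorting mediates between the two.\<close>

definition sort_triple :: "nat \<Rightarrow> nat \<Rightarrow> nat \<Rightarrow> triangle" where
  "sort_triple i j k =
     (min i (min j k), max (min i j) (min (max i j) k), max i (max j k))"

lemma sort_pair_commute: "sort_pair i j = sort_pair j i"
  by (simp add: sort_pair_def min.commute max.commute)

lemma sort_pair_component: "fst (sort_pair i j) = i \<or> snd (sort_pair i j) = i"
  by (simp add: sort_pair_def min_def max_def)

lemma sort_pair_inj: "sort_pair i a = sort_pair i b \<Longrightarrow> a = b"
  by (cases i a rule: le_cases; cases i b rule: le_cases) (simp_all add: sort_pair_def)

lemma sort_triple_swap12: "sort_triple i j k = sort_triple j i k"
  by (simp add: sort_triple_def min.commute min.left_commute max.commute max.left_commute)

lemma sort_triple_swap23: "sort_triple i j k = sort_triple i k j"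
  by (auto simp: sort_triple_def min_def max_def)

lemma sort_triple_sorted: "i < j \<Longrightarrow> j < k \<Longrightarrow> sort_triple i j k = (i, j, k)"
  by (simp add: sort_triple_def)

lemma distinct_nats_cases:
  fixes i j k :: nat
  assumes "i \<noteq> j" "j \<noteq> k" "i \<noteq> k"
  obtains "i < j" "j < k" "i < k" | "i < k" "k < j" "i < j" | "j < i" "i < k" "j < k"
    | "j < k" "k < i" "j < i" | "k < i" "i < j" "k < j" | "k < j" "j < i" "k < i"
  using assms by (meson linorder_neqE_nat order.strict_trans)

lemma tri_edges_sort_triple:
  assumes "i \<noteq> j" "j \<noteq> k" "i \<noteq> k"
  shows "tri_edges (sort_triple i j k) = {sort_pair i j, sort_pair j k, sort_pair i k}"
  using assms by (cases rule: distinct_nats_cases) (simp_all add: sort_triple_def sort_pair_def insert_commute)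

lemma sort_triple_in_K_triples:
  assumes "i \<noteq> j" "j \<noteq> k" "i \<noteq> k" "i \<in> {1..n}" "j \<in> {1..n}" "k \<in> {1..n}"
  shows "sort_triple i j k \<in> K_triples n"
  using assms(1-3) by (cases rule: distinct_nats_cases) (use assms(4-6) in \<open>simp_all add: sort_triple_def K_triples_def\<close>)

text \<open>Sorting preserves the sum of the entries, and the sum determines the last one.\<close>

lemma sort_triple_inj:
  assumes "sort_triple i j a = sort_triple i j b"
  shows "a = b"
proof -
  have total: "fst (sort_triple i j c) + fst (snd (sort_triple i j c)) + snd (snd (sort_triple i j c))
      = i + j + c" for c
    by (cases i j rule: le_cases; cases j c rule: le_cases; cases i c rule: le_cases)
      (simp_all add: sort_triple_def)
  show ?thesis using total[of a, unfolded assms] total[of b] by linarith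
qed

lemma finite_K_triples: "finite (K_triples n)"
  by (rule finite_subset[of _ "{1..n} \<times> {1..n} \<times> {1..n}"]) (auto simp: K_triples_def)

lemma triples_on_edge:
  assumes "1 \<le> i" "i < j" "j \<le> n"
  shows "{u \<in> K_triples n. (i, j) \<in> tri_edges u} = sort_triple i j ` ({1..n} - {i, j})"
proof (intro equalityI subsetI)
  fix u assume u: "u \<in> {u \<in> K_triples n. (i, j) \<in> tri_edges u}"
  obtain p q r where pqr: "u = (p, q, r)" by (cases u)
  consider "p = i" "q = j" | "q = i" "r = j" | "p = i" "r = j"
    using u pqr by auto
  then show "u \<in> sort_triple i j ` ({1..n} - {i, j})"
  proof cases
    case 1
    then show ?thesis using u pqr by (intro image_eqI[of _ _ r]) (auto simp: K_triples_def sort_triple_def)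
  next
    case 2
    then show ?thesis using u pqr by (intro image_eqI[of _ _ p]) (auto simp: K_triples_def sort_triple_def)
  next
    case 3
    then show ?thesis using u pqr by (intro image_eqI[of _ _ q]) (auto simp: K_triples_def sort_triple_def)
  qed
next
  fix u assume "u \<in> sort_triple i j ` ({1..n} - {i, j})"
  then show "u \<in> {u \<in> K_triples n. (i, j) \<in> tri_edges u}"
    using assms by (auto simp: K_triples_def sort_triple_def min_def max_def)
qed

text \<open>Two edges of a triple already contain its three vertices.\<close>

lemma common_edge_unique:
  assumes "t \<in> K_triples n" "u \<in> K_triples n" "t \<noteq> u"
    and "e \<in> tri_edges t" "e \<in> tri_edges u" "e' \<in> tri_edges t" "e' \<in> tri_edges u"
  shows "e = e'"
proof -
  obtain i j k where t: "t = (i, j, k)" "i < j" "j < k"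
    using assms(1) by (auto simp: K_triples_def)
  obtain p q r where u: "u = (p, q, r)" "p < q" "q < r"
    using assms(2) by (auto simp: K_triples_def)
  show ?thesis using assms(3-) t(2,3) u(2,3) unfolding t(1) u(1) by auto
qed

definition neighbours :: "triangle set \<Rightarrow> triangle \<Rightarrow> triangle set" where
  "neighbours A t = {u \<in> A. u \<noteq> t \<and> tri_edges t \<inter> tri_edges u \<noteq> {}}"

text \<open>Each neighbour shares exactly one edge with \<open>t\<close>. On the right
  \<open>t\<close> itself occurs once per edge, hence the condition \<open>f t = 0\<close>.\<close>

lemma sum_neighbours:
  fixes f :: "triangle \<Rightarrow> 'a :: comm_monoid_add"
  assumes A: "A \<subseteq> K_triples n" and t: "t \<in> K_triples n" and "f t = 0"
  shows "(\<Sum>u\<in>neighbours A t. f u) = (\<Sum>e\<in>tri_edges t. \<Sum>u | u \<in> A \<and> e \<in> tri_edges u. f u)"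
proof -
  have fin: "finite A" using A finite_K_triples finite_subset by blast
  have fe: "finite (tri_edges t)" by (cases t) auto
  have "neighbours A t = (\<Union>e\<in>tri_edges t. {u \<in> A - {t}. e \<in> tri_edges u})"
    by (auto simp: neighbours_def)
  then have "(\<Sum>u\<in>neighbours A t. f u) = (\<Sum>e\<in>tri_edges t. \<Sum>u\<in>{u \<in> A - {t}. e \<in> tri_edges u}. f u)"
  proof (simp only:, intro sum.UNION_disjoint ballI impI)
    fix e e' assume e: "e \<in> tri_edges t" "e' \<in> tri_edges t" "e \<noteq> e'"
    show "{u \<in> A - {t}. e \<in> tri_edges u} \<inter> {u \<in> A - {t}. e' \<in> tri_edges u} = {}"
    proof (rule ccontr)
      assume "\<not> ?thesis"
      then obtain u where "u \<in> A" "u \<noteq> t" "e \<in> tri_edges u" "e' \<in> tri_edges u" by blast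
      then show False using common_edge_unique[OF t, of u e e'] A e by blast
    qed
  qed (use fin fe in auto)
  also have "\<dots> = (\<Sum>e\<in>tri_edges t. \<Sum>u | u \<in> A \<and> e \<in> tri_edges u. f u)"
    using fin \<open>f t = 0\<close> by (intro sum.cong refl sum.mono_neutral_left) auto
  finally show ?thesis .
qed

lemma card_neighbours_le:
  assumes "A \<subseteq> K_triples n" "t \<in> K_triples n"
    and "\<And>e. e \<in> tri_edges t \<Longrightarrow> card {u \<in> A. e \<in> tri_edges u} \<le> b"
  shows "card (neighbours A t) \<le> 3 * b"
proof -
  have fin: "finite A" using assms(1) finite_K_triples finite_subset by blast
  obtain i j k where t: "t = (i, j, k)" by (cases t)
  have "neighbours A t \<subseteq> {u \<in> A. (i, j) \<in> tri_edges u} \<union> {u \<in> A. (j, k) \<in> tri_edges u}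
      \<union> {u \<in> A. (i, k) \<in> tri_edges u}"
    by (auto simp: neighbours_def t)
  then have "card (neighbours A t) \<le> card ({u \<in> A. (i, j) \<in> tri_edges u} \<union> {u \<in> A. (j, k) \<in> tri_edges u}
      \<union> {u \<in> A. (i, k) \<in> tri_edges u})"
    using fin by (intro card_mono) auto
  also have "\<dots> \<le> card {u \<in> A. (i, j) \<in> tri_edges u} + card {u \<in> A. (j, k) \<in> tri_edges u}
      + card {u \<in> A. (i, k) \<in> tri_edges u}"
    by (intro order_trans[OF card_Un_le] add_right_mono card_Un_le)
  also have "\<dots> \<le> b + b + b" using assms(3) by (intro add_mono) (auto simp: t)
  finally show ?thesis by simp
qed

lemma tri_edges_cases:
  assumes "t \<in> K_triples n" "e \<in> tri_edges t"
  obtains i j where "e = (i, j)" "1 \<le> i" "i < j" "j \<le> n"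
proof -
  have "e \<in> K_edges n" using assms by (auto simp: K_triples_def K_edges_def)
  then show thesis using that by (auto simp: K_edges_def)
qed

lemma card_neighbours_K_triples:
  assumes "A \<subseteq> K_triples n" "t \<in> K_triples n"
  shows "card (neighbours A t) \<le> 3 * n"
proof (rule card_neighbours_le[OF assms])
  fix e assume e: "e \<in> tri_edges t"
  obtain i j where ij: "e = (i, j)" "1 \<le> i" "i < j" "j \<le> n"
    using tri_edges_cases[OF assms(2) e] .
  have "card {u \<in> A. e \<in> tri_edges u} \<le> card {u \<in> K_triples n. (i, j) \<in> tri_edges u}"
    using assms(1) finite_K_triples ij(1) by (intro card_mono) auto
  also have "\<dots> \<le> card ({1..n} - {i, j})"
    unfolding triples_on_edge[OF ij(2-4)] by (intro card_image_le) auto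
  also have "\<dots> \<le> card {1..n}" by (intro card_mono) auto
  finally show "card {u \<in> A. e \<in> tri_edges u} \<le> n" by simp
qed

subsection \<open>Clean triangles\<close>

locale clean_triangles =
  fixes n :: nat and E0 Eb :: "edge set" and D :: real
  assumes n_pos: "0 < n"
    and partition: "E0 \<union> Eb = K_edges n" "E0 \<inter> Eb = {}"
    and corrupted_degree: "\<And>i. i \<in> {1..n} \<Longrightarrow> real (card {e \<in> Eb. fst e = i \<or> snd e = i}) \<le> D"
begin

definition clean :: "nat \<Rightarrow> nat \<Rightarrow> real" where
  "clean i j = of_bool (sort_pair i j \<in> E0)"

abbreviation T0 :: "triangle set" where
  "T0 \<equiv> clean_triples n E0"

lemma edges_subset: "E0 \<subseteq> K_edges n" "Eb \<subseteq> K_edges n"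
  using partition(1) by blast+

lemma sort_pair_E0D:
  assumes "sort_pair i j \<in> E0"
  shows "i \<noteq> j"
proof -
  have "sort_pair i j \<in> K_edges n" using assms edges_subset by blast
  then show ?thesis unfolding K_edges_def sort_pair_def by fastforce
qed

lemma sort_pair_K_edges:
  "i \<noteq> j \<Longrightarrow> i \<in> {1..n} \<Longrightarrow> j \<in> {1..n} \<Longrightarrow> sort_pair i j \<in> K_edges n"
  by (cases i j rule: linorder_cases) (simp_all add: K_edges_def sort_pair_def)

lemma finite_Eb: "finite Eb"
proof (rule finite_subset[OF edges_subset(2)])
  show "finite (K_edges n)"
    by (rule finite_subset[of _ "{1..n} \<times> {1..n}"]) (auto simp: K_edges_def)
qed

lemma card_corrupted_partners:
  assumes "i \<in> {1..n}"
  shows "real (card {a \<in> {1..n}. sort_pair i a \<in> Eb}) \<le> D"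
proof -
  have "card {a \<in> {1..n}. sort_pair i a \<in> Eb} \<le> card {e \<in> Eb. fst e = i \<or> snd e = i}"
  proof (rule card_inj_on_le)
    show "inj_on (sort_pair i) {a \<in> {1..n}. sort_pair i a \<in> Eb}"
      by (intro inj_onI) (rule sort_pair_inj)
    show "sort_pair i ` {a \<in> {1..n}. sort_pair i a \<in> Eb} \<subseteq> {e \<in> Eb. fst e = i \<or> snd e = i}"
      using sort_pair_component[of i] by (simp add: image_subset_iff)
  qed (use finite_Eb in auto)
  then show ?thesis using corrupted_degree[OF assms] by linarith
qed

text \<open>The extra \<open>1\<close> is the diagonal: \<open>sort_pair i i\<close> is not an edge,
  so \<open>clean i i = 0\<close>.\<close>

lemma clean_defect:
  assumes "i \<in> {1..n}"
  shows "(\<Sum>j=1..n. 1 - clean i j) \<le> D + 1"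
proof -
  have "(\<Sum>j=1..n. 1 - clean i j) \<le> (\<Sum>j=1..n. of_bool (sort_pair i j \<in> Eb) + of_bool (j = i))"
  proof (intro sum_mono)
    fix j assume "j \<in> {1..n}"
    then show "1 - clean i j \<le> of_bool (sort_pair i j \<in> Eb) + of_bool (j = i)"
      using sort_pair_K_edges[of i j] assms partition(1)
      by (cases "sort_pair i j \<in> E0"; cases "sort_pair i j \<in> Eb"; cases "j = i") (simp_all add: clean_def, blast)
  qed
  also have "\<dots> = (\<Sum>j=1..n. of_bool (sort_pair i j \<in> Eb)) + 1"
    using assms by (simp add: sum.distrib of_bool_def)
  also have "(\<Sum>j=1..n. of_bool (sort_pair i j \<in> Eb)) = real (card {a \<in> {1..n}. sort_pair i a \<in> Eb})"
    by (simp add: of_bool_def sum.If_cases Int_def)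
  finally show ?thesis using card_corrupted_partners[OF assms] by linarith
qed

sublocale dense_graph "{1..n}" clean "D + 1"
  by unfold_locales
    (use n_pos clean_defect in \<open>auto simp: clean_def sort_pair_commute\<close>)

lemma T0_K_triples: "T0 \<subseteq> K_triples n"
  by (auto simp: clean_triples_def)

lemma finite_T0: "finite T0"
  using T0_K_triples finite_K_triples finite_subset by blast

lemma sort_triple_in_T0_iff:
  assumes "i \<in> {1..n}" "j \<in> {1..n}" "k \<in> {1..n}"
  shows "tri i j k = 1 \<longleftrightarrow> i \<noteq> j \<and> j \<noteq> k \<and> i \<noteq> k \<and> sort_triple i j k \<in> T0"
proof -
  have "tri i j k = 1 \<longleftrightarrow> sort_pair i j \<in> E0 \<and> sort_pair j k \<in> E0 \<and> sort_pair i k \<in> E0"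
    by (auto simp: tri_def clean_def)
  then show ?thesis
    using sort_pair_E0D sort_triple_in_K_triples[OF _ _ _ assms] tri_edges_sort_triple[of i j k]
    unfolding clean_triples_def by auto
qed

lemma sum_clean_on_edge:
  fixes f :: "triangle \<Rightarrow> real"
  assumes ij: "1 \<le> i" "i < j" "j \<le> n"
  shows "(\<Sum>u | u \<in> T0 \<and> (i, j) \<in> tri_edges u. f u) = (\<Sum>a=1..n. tri i j a * f (sort_triple i j a))"
proof -
  have mem: "i \<in> {1..n}" "j \<in> {1..n}" using ij by auto
  have "{u. u \<in> T0 \<and> (i, j) \<in> tri_edges u} = sort_triple i j ` {a \<in> {1..n}. tri i j a = 1}"
  proof -
    have "{u. u \<in> T0 \<and> (i, j) \<in> tri_edges u} = {u \<in> K_triples n. (i, j) \<in> tri_edges u} \<inter> T0"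
      using T0_K_triples by auto
    also have "\<dots> = sort_triple i j ` {a \<in> {1..n}. tri i j a = 1}"
      unfolding triples_on_edge[OF ij] using sort_triple_in_T0_iff[OF mem] ij by auto
    finally show ?thesis .
  qed
  then have "(\<Sum>u | u \<in> T0 \<and> (i, j) \<in> tri_edges u. f u)
      = (\<Sum>a\<in>{a \<in> {1..n}. tri i j a = 1}. f (sort_triple i j a))"
    using sum.reindex[OF inj_onI[OF sort_triple_inj]] by simp
  also have "\<dots> = (\<Sum>a\<in>{a \<in> {1..n}. tri i j a = 1}. tri i j a * f (sort_triple i j a))"
    by (intro sum.cong) auto
  also have "\<dots> = (\<Sum>a=1..n. tri i j a * f (sort_triple i j a))"
    using tri_cases by (intro sum.mono_neutral_left) auto
  finally show ?thesis .
qed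

text \<open>A neighbour outside \<open>T0\<close> shares a clean edge with \<open>t\<close>, so its
  third vertex is a corrupted partner of one end of that edge: at most \<open>2 * D\<close>
  triangles on each of three edges.\<close>

lemma card_corrupted_neighbours:
  assumes A: "A \<subseteq> K_triples n" and t: "t \<in> T0"
  shows "real (card (neighbours A t - T0)) \<le> 6 * D"
proof -
  define b where "b = nat \<lfloor>2 * D\<rfloor>"
  have D: "0 \<le> D" using corrupted_degree[of 1] n_pos of_nat_0_le_iff[of "card {e \<in> Eb. fst e = 1 \<or> snd e = 1}"] by force
  have "card {u \<in> A - T0. e \<in> tri_edges u} \<le> b" if e: "e \<in> tri_edges t" for e
  proof -
    obtain i j where ij: "e = (i, j)" "1 \<le> i" "i < j" "j \<le> n"
      using tri_edges_cases[OF _ e] t T0_K_triples by blast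
    then have mem: "i \<in> {1..n}" "j \<in> {1..n}" by auto
    have eE: "sort_pair i j \<in> E0" using e t ij by (auto simp: clean_triples_def sort_pair_def)
    let ?B = "\<lambda>i. {a \<in> {1..n}. sort_pair i a \<in> Eb}"
    have "{u \<in> A - T0. e \<in> tri_edges u} \<subseteq> sort_triple i j ` (?B i \<union> ?B j)"
    proof
      fix u assume u: "u \<in> {u \<in> A - T0. e \<in> tri_edges u}"
      then obtain a where a: "a \<in> {1..n}" "a \<noteq> i" "a \<noteq> j" "u = sort_triple i j a"
        using triples_on_edge[OF ij(2-4)] A ij(1) by blast
      then have "\<not> tri i j a = 1" using u sort_triple_in_T0_iff[OF mem] by auto
      then have "sort_pair i a \<notin> E0 \<or> sort_pair j a \<notin> E0"
        using eE by (auto simp: tri_def clean_def)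
      then have "a \<in> ?B i \<union> ?B j"
        using a partition(1) sort_pair_K_edges[of i a] sort_pair_K_edges[of j a] mem by auto
      then show "u \<in> sort_triple i j ` (?B i \<union> ?B j)" using a(4) by blast
    qed
    then have "card {u \<in> A - T0. e \<in> tri_edges u} \<le> card (sort_triple i j ` (?B i \<union> ?B j))"
      by (intro card_mono) auto
    also have "\<dots> \<le> card (?B i \<union> ?B j)" by (intro card_image_le) auto
    also have "\<dots> \<le> card (?B i) + card (?B j)" by (rule card_Un_le)
    finally have "real (card {u \<in> A - T0. e \<in> tri_edges u}) \<le> real (card (?B i)) + real (card (?B j))"
      by linarith
    then have "real (card {u \<in> A - T0. e \<in> tri_edges u}) \<le> 2 * D"
      using card_corrupted_partners[OF mem(1)] card_corrupted_partners[OF mem(2)] by linarith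
    then show ?thesis unfolding b_def by linarith
  qed
  then have "card (neighbours (A - T0) t) \<le> 3 * b"
    using A t T0_K_triples by (intro card_neighbours_le[of _ n]) auto
  moreover have "neighbours (A - T0) t = neighbours A t - T0" by (auto simp: neighbours_def)
  moreover have "real b \<le> 2 * D" using D unfolding b_def by linarith
  ultimately show ?thesis by simp
qed

end

subsection \<open>The Green bound\<close>

text \<open>The centre is the midpoint of maximum and minimum. The extremal points are recorded
  because they turn a bound on differences into a bound on \<open>b\<close>.\<close>

lemma half_range:
  fixes y :: "'a \<Rightarrow> real"
  assumes "finite A" "A \<noteq> {}"
  shows "\<exists>\<alpha> b. \<exists>p\<in>A. \<exists>q\<in>A. y p - y q = 2 * b \<and> (\<forall>t\<in>A. \<bar>y t - \<alpha>\<bar> \<le> b)"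
proof -
  have im: "finite (y ` A)" "y ` A \<noteq> {}" using assms by auto
  obtain p where p: "p \<in> A" "Max (y ` A) = y p" using Max_in[OF im] by auto
  obtain q where q: "q \<in> A" "Min (y ` A) = y q" using Min_in[OF im] by auto
  have le: "y t \<le> y p" "y q \<le> y t" if "t \<in> A" for t
    using Max_ge[OF im(1), of "y t"] Min_le[OF im(1), of "y t"] that p(2) q(2) by simp_all
  have "\<forall>t\<in>A. \<bar>y t - (y p + y q) / 2\<bar> \<le> (y p - y q) / 2"
  proof
    fix t assume "t \<in> A"
    from le[OF this] show "\<bar>y t - (y p + y q) / 2\<bar> \<le> (y p - y q) / 2"
      by (simp add: abs_le_iff field_simps)
  qed
  moreover have "y p - y q = 2 * ((y p - y q) / 2)" by simp
  ultimately show ?thesis using p(1) q(1) by blast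
qed

context clean_triangles
begin

lemma tri_mem:
  assumes "tri i j k = 1"
  shows "i \<in> {1..n}" "j \<in> {1..n}" "k \<in> {1..n}" "i \<noteq> j" "j \<noteq> k" "i \<noteq> k"
proof -
  have mem: "sort_pair a b \<in> E0 \<Longrightarrow> a \<in> {1..n} \<and> b \<in> {1..n}" for a b
  proof -
    assume "sort_pair a b \<in> E0"
    then have "sort_pair a b \<in> K_edges n" using edges_subset by blast
    then have "1 \<le> min a b" "max a b \<le> n" by (simp_all add: sort_pair_def K_edges_def)
    then show ?thesis by simp
  qed
  have "sort_pair i j \<in> E0" "sort_pair j k \<in> E0" "sort_pair i k \<in> E0"
    using assms by (simp_all add: tri_def clean_def of_bool_def split: if_splits)
  then show "i \<in> {1..n}" "j \<in> {1..n}" "k \<in> {1..n}" "i \<noteq> j" "j \<noteq> k" "i \<noteq> k"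
    using mem sort_pair_E0D by blast+
qed

lemma sum_clean_on_sort_pair:
  fixes f :: "triangle \<Rightarrow> real"
  assumes "i \<noteq> j" "i \<in> {1..n}" "j \<in> {1..n}"
  shows "(\<Sum>u | u \<in> T0 \<and> sort_pair i j \<in> tri_edges u. f u) = (\<Sum>a=1..n. tri i j a * f (sort_triple i j a))"
proof (cases "i < j")
  case True
  then have "sort_pair i j = (i, j)" by (simp add: sort_pair_def)
  then show ?thesis using sum_clean_on_edge[of i j f] True assms by simp
next
  case False
  then have "sort_pair i j = (j, i)" by (simp add: sort_pair_def)
  moreover have "(\<Sum>a=1..n. tri i j a * f (sort_triple i j a)) = (\<Sum>a=1..n. tri j i a * f (sort_triple j i a))"
    by (simp only: tri_swap12[of i] sort_triple_swap12[of i])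
  ultimately show ?thesis using sum_clean_on_edge[of j i f] False assms by simp
qed

lemma sum_clean_neighbours:
  fixes f :: "triangle \<Rightarrow> real"
  assumes "tri i j k = 1" "f (sort_triple i j k) = 0"
  shows "(\<Sum>u\<in>neighbours T0 (sort_triple i j k). f u)
    = (\<Sum>a=1..n. tri i j a * f (sort_triple i j a)) + (\<Sum>a=1..n. tri j k a * f (sort_triple j k a))
      + (\<Sum>a=1..n. tri k i a * f (sort_triple k i a))"
proof -
  note mem = tri_mem[OF assms(1)]
  have neq: "sort_pair i j \<noteq> sort_pair j k" "sort_pair i j \<noteq> sort_pair k i" "sort_pair j k \<noteq> sort_pair k i"
    using mem(4-6) sort_pair_inj[of j i k] sort_pair_inj[of i j k] sort_pair_inj[of k j i]
      sort_pair_commute[of i j] sort_pair_commute[of j k] sort_pair_commute[of k i] by metis+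
  have edges: "tri_edges (sort_triple i j k) = {sort_pair i j, sort_pair j k, sort_pair k i}"
    unfolding tri_edges_sort_triple[OF mem(4-6)] sort_pair_commute[of i k] ..
  have "(\<Sum>u\<in>neighbours T0 (sort_triple i j k). f u)
    = (\<Sum>e\<in>tri_edges (sort_triple i j k). \<Sum>u | u \<in> T0 \<and> e \<in> tri_edges u. f u)"
    by (rule sum_neighbours[where n = n])
      (use T0_K_triples sort_triple_in_K_triples[OF mem(4-6) mem(1-3)] assms(2) in auto)
  also have "\<dots> = (\<Sum>u | u \<in> T0 \<and> sort_pair i j \<in> tri_edges u. f u)
      + (\<Sum>u | u \<in> T0 \<and> sort_pair j k \<in> tri_edges u. f u) + (\<Sum>u | u \<in> T0 \<and> sort_pair k i \<in> tri_edges u. f u)"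
    unfolding edges using neq by (simp add: add.assoc)
  finally show ?thesis
    using sum_clean_on_sort_pair[of i j f] sum_clean_on_sort_pair[of j k f] sum_clean_on_sort_pair[of k i f] mem
    by simp
qed

lemma clean_laplacian_bound:
  fixes y :: "triangle \<Rightarrow> real"
  assumes lap: "\<And>t. t \<in> T0 \<Longrightarrow> \<bar>\<Sum>u\<in>neighbours T0 t. y t - y u\<bar> \<le> \<gamma>" and "0 \<le> \<gamma>"
    and range: "\<And>t. t \<in> T0 \<Longrightarrow> \<bar>y t - \<alpha>\<bar> \<le> b" and "0 \<le> b"
    and pq: "p \<in> T0" "q \<in> T0"
  shows "real n * (y p - y q) \<le> 2 * (11 / 6 * \<gamma> + 9 * (D + 1) * b)"
proof -
  \<comment> \<open>Centring before the extension by zero makes all errors proportional to the bound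
    on \<open>y - \<alpha>\<close> instead of the size of \<open>y\<close>.\<close>
  define Y where "Y i j k = tri i j k * (y (sort_triple i j k) - \<alpha>)" for i j k
  interpret P: triple_potential "{1..n}" clean "D + 1" Y b
  proof unfold_locales
    fix i j k
    show "Y i j k = Y j i k" unfolding Y_def by (simp only: tri_swap12[of i] sort_triple_swap12[of i])
    show "Y i j k = Y i k j" unfolding Y_def by (simp only: tri_swap23[of i j] sort_triple_swap23[of i j])
    show "tri i j k * Y i j k = Y i j k" unfolding Y_def using tri_cases[of i j k] by auto
    show "\<bar>Y i j k\<bar> \<le> b"
    proof (cases "tri i j k = 1")
      case True
      then have "sort_triple i j k \<in> T0" using tri_mem[OF True] sort_triple_in_T0_iff by blast
      then show ?thesis unfolding Y_def using True range by simp
    next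
      case False
      then show ?thesis unfolding Y_def using tri_cases[of i j k] \<open>0 \<le> b\<close> by auto
    qed
  qed
  have flow: "P.edge_flow i j k = (\<Sum>a=1..n. tri i j a * (y (sort_triple i j k) - y (sort_triple i j a)))"
    if "tri i j k = 1" for i j k
  proof -
    have "(\<Sum>a=1..n. tri i j a * (y (sort_triple i j k) - y (sort_triple i j a)))
      = (\<Sum>a=1..n. tri i j a * (y (sort_triple i j k) - \<alpha>) - Y i j a)"
      unfolding Y_def by (simp add: algebra_simps del: One_nat_def)
    then show ?thesis
      using that by (simp add: P.edge_flow_def P.edge_sum_def codeg_def Y_def[of i j k] sum_subtractf sum_distrib_right
          del: One_nat_def)
  qed
  have "\<bar>P.laplacian i j k\<bar> \<le> \<gamma>" for i j k
  proof (cases "tri i j k = 1")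
    case True
    have cyc: "tri j k i = tri i j k" "tri k i j = tri i j k"
      "sort_triple j k i = sort_triple i j k" "sort_triple k i j = sort_triple i j k"
      by (simp_all only: tri_swap12[of k i] tri_swap23[of j k] tri_swap12[of j i] tri_swap23[of i k]
          sort_triple_swap12[of k i] sort_triple_swap23[of j k] sort_triple_swap12[of j i] sort_triple_swap23[of i k])
    have "P.laplacian i j k = (\<Sum>u\<in>neighbours T0 (sort_triple i j k). y (sort_triple i j k) - y u)"
      using sum_clean_neighbours[OF True, of "\<lambda>u. y (sort_triple i j k) - y u"]
        flow[of i j k] flow[of j k i] flow[of k i j] True cyc
      by (simp add: P.laplacian_def del: One_nat_def)
    moreover have "sort_triple i j k \<in> T0" using tri_mem[OF True] sort_triple_in_T0_iff True by blast
    ultimately show ?thesis using lap by simp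
  next
    case False
    then have "tri i j k = 0" using tri_cases by blast
    moreover have "tri j k i = tri i j k" "tri k i j = tri i j k"
      by (simp_all only: tri_swap12[of k i] tri_swap23[of j k] tri_swap12[of j i] tri_swap23[of i k])
    ultimately show ?thesis using \<open>0 \<le> \<gamma>\<close> by (simp add: P.laplacian_def P.edge_flow_def del: One_nat_def)
  qed
  note lap' = this
  define N where "N = real n"
  have N: "0 < N" using n_pos by (simp add: N_def)
  have *: "\<bar>N ^ 3 * (y t - \<alpha>) - P.total_sum\<bar> \<le> N\<^sup>2 * (11 / 6 * \<gamma> + 9 * (D + 1) * b)" if t: "t \<in> T0" for t
  proof -
    obtain i j k where ijk: "t = (i, j, k)" "1 \<le> i" "i < j" "j < k" "k \<le> n"
      using t T0_K_triples by (auto simp: K_triples_def)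
    then have "sort_triple i j k = t" by (simp add: sort_triple_sorted)
    moreover have "tri i j k = 1" using sort_triple_in_T0_iff[of i j k] ijk t calculation by simp
    ultimately show ?thesis
      using P.potential_approx[of \<gamma> i j k, OF lap'] ijk unfolding N_def by (simp add: Y_def)
  qed
  define Z where "Z = 11 / 6 * \<gamma> + 9 * (D + 1) * b"
  \<comment> \<open>All values are close to the same \<open>P.total_sum\<close>, which drops out of
    the difference; the two errors give the factor \<open>2\<close>.\<close>
  have "N\<^sup>2 * (N * (y p - y q)) = (N ^ 3 * (y p - \<alpha>) - P.total_sum) - (N ^ 3 * (y q - \<alpha>) - P.total_sum)"
    by (simp add: algebra_simps power2_eq_square power3_eq_cube)
  also have "\<dots> \<le> N\<^sup>2 * (2 * Z)"
    using *[OF pq(1)] *[OF pq(2)] unfolding Z_def[symmetric] by linarith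
  finally show ?thesis using N by (simp add: N_def Z_def)
qed

text \<open>Adjacency is symmetric. A Laplacian thus has mean zero, which bounds the free constant
  \<open>\<beta>\<close> of the Green bound.\<close>

lemma sum_clean_laplacian: "(\<Sum>t\<in>T0. \<Sum>u\<in>neighbours T0 t. y t - y u) = (0 :: real)"
proof -
  have eq: "neighbours T0 t = {u \<in> T0. u \<noteq> t \<and> tri_edges t \<inter> tri_edges u \<noteq> {}}" for t
    by (simp add: neighbours_def)
  have "(\<Sum>t\<in>T0. \<Sum>u\<in>neighbours T0 t. y u) = (\<Sum>u\<in>T0. \<Sum>t\<in>{t \<in> T0. u \<noteq> t \<and> tri_edges t \<inter> tri_edges u \<noteq> {}}. y u)"
    unfolding eq by (rule sum.swap_restrict[OF finite_T0 finite_T0])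
  also have "\<dots> = (\<Sum>u\<in>T0. \<Sum>t\<in>neighbours T0 u. y u)"
    unfolding eq by (intro sum.cong refl) auto
  finally show ?thesis by (simp add: sum_subtractf)
qed

lemma clean_green:
  fixes y :: "triangle \<Rightarrow> real"
  assumes D: "D \<le> real n / 384" and n: "100 \<le> n"
    and lap: "\<And>t. t \<in> T0 \<Longrightarrow> \<bar>(\<Sum>u\<in>neighbours T0 t. y t - y u) - \<beta>\<bar> \<le> \<gamma>"
    and range: "\<And>t. t \<in> T0 \<Longrightarrow> \<bar>y t - \<alpha>\<bar> \<le> b" and pq: "p \<in> T0" "q \<in> T0" "y p - y q = 2 * b"
  shows "real n * b \<le> 32 / 7 * \<gamma>"
proof -
  have c: "0 < real (card T0)" using pq(1) finite_T0 by (auto simp: card_gt_0_iff)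
  have "real (card T0) * \<bar>\<beta>\<bar> = \<bar>\<Sum>t\<in>T0. (\<Sum>u\<in>neighbours T0 t. y t - y u) - \<beta>\<bar>"
    using sum_clean_laplacian[of y] by (simp add: sum_subtractf[of _ "\<lambda>_. \<beta>"] abs_mult)
  also have "\<dots> \<le> (\<Sum>t\<in>T0. \<gamma>)" by (rule order_trans[OF sum_abs sum_mono]) (rule lap)
  finally have \<beta>: "\<bar>\<beta>\<bar> \<le> \<gamma>" using c by simp
  have b: "0 \<le> b" using range[OF pq(1)] by linarith
  \<comment> \<open>Removing \<open>\<beta>\<close> doubles \<open>\<gamma>\<close>, so
    \<open>11/6\<close> becomes \<open>11/3\<close>.\<close>
  have "real n * (y p - y q) \<le> 2 * (11 / 6 * (2 * \<gamma>) + 9 * (D + 1) * b)"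
  proof (rule clean_laplacian_bound)
    fix t assume "t \<in> T0"
    then show "\<bar>\<Sum>u\<in>neighbours T0 t. y t - y u\<bar> \<le> 2 * \<gamma>" using lap[of t] \<beta> by linarith
  qed (use \<beta> range b pq in auto)
  then have "real n * b \<le> 11 / 3 * \<gamma> + 9 * (D + 1) * b" unfolding pq(3) by (simp add: algebra_simps)
  moreover have "100 \<le> real n" using n by simp
  \<comment> \<open>The fraction \<open>19/96 = 1 - (11/3) / (32/7)\<close> is exactly what the
    left-hand side can absorb if the final constant is to be \<open>32/7\<close>.\<close>
  then have "9 * (D + 1) \<le> 19 / 96 * real n" using D by (simp add: field_simps)
  then have "9 * (D + 1) * b \<le> 19 / 96 * real n * b" using b by (rule mult_right_mono)
  ultimately show ?thesis by linarith
qed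

text \<open>The defect \<open>1 - W\<close> is a perturbation: at most \<open>3 * n\<close>
  neighbours, each with a difference of at most two half-ranges, hence the factor \<open>6\<close>.
  It is absorbed on the left, which multiplies the constant by \<open>1 / (1 - \<beta>)\<close> for
  the \<open>\<beta>\<close> of the theorem.\<close>

lemma clean_green_weighted:
  fixes y :: "triangle \<Rightarrow> real" and W :: "triangle \<Rightarrow> triangle \<Rightarrow> real"
  assumes D: "D \<le> real n / 384" and n: "100 \<le> n"
    and W: "\<And>t u. t \<in> T0 \<Longrightarrow> u \<in> neighbours T0 t \<Longrightarrow> m \<le> W t u \<and> W t u \<le> 1" and "m \<le> 1"
    and G: "6 * (32 / 7) * (1 - m) < 1" "32 / 7 / (1 - 6 * (32 / 7) * (1 - m)) \<le> G"
    and lap: "\<And>t. t \<in> T0 \<Longrightarrow> \<bar>(\<Sum>u\<in>neighbours T0 t. W t u * (y t - y u)) - \<beta>\<bar> \<le> \<gamma>"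
    and range: "\<And>t. t \<in> T0 \<Longrightarrow> \<bar>y t - \<alpha>\<bar> \<le> b" and pq: "p \<in> T0" "q \<in> T0" "y p - y q = 2 * b"
  shows "real n * b \<le> G * \<gamma>"
proof -
  have b: "0 \<le> b" using range[OF pq(1)] by linarith
  have \<gamma>: "0 \<le> \<gamma>" using lap[OF pq(1)] by linarith
  have "real n * b \<le> 32 / 7 * (\<gamma> + 3 * real n * ((1 - m) * (2 * b)))"
  proof (rule clean_green[OF D n _ range pq])
    fix t assume t: "t \<in> T0"
    have "(\<Sum>u\<in>neighbours T0 t. y t - y u) - (\<Sum>u\<in>neighbours T0 t. W t u * (y t - y u))
        = (\<Sum>u\<in>neighbours T0 t. (1 - W t u) * (y t - y u))"
      unfolding sum_subtractf[symmetric] by (simp add: algebra_simps)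
    moreover have "\<bar>\<Sum>u\<in>neighbours T0 t. (1 - W t u) * (y t - y u)\<bar> \<le> (\<Sum>u\<in>neighbours T0 t. (1 - m) * (2 * b))"
    proof (rule order_trans[OF sum_abs sum_mono])
      fix u assume u: "u \<in> neighbours T0 t"
      then have "u \<in> T0" by (simp add: neighbours_def)
      then have "\<bar>y t - y u\<bar> \<le> 2 * b" using range[OF t] range[of u] by linarith
      moreover have "\<bar>1 - W t u\<bar> \<le> 1 - m" using W[OF t u] by linarith
      ultimately show "\<bar>(1 - W t u) * (y t - y u)\<bar> \<le> (1 - m) * (2 * b)"
        unfolding abs_mult using \<open>m \<le> 1\<close> by (intro mult_mono) auto
    qed
    moreover have "(\<Sum>u\<in>neighbours T0 t. (1 - m) * (2 * b)) \<le> 3 * real n * ((1 - m) * (2 * b))"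
    proof -
      have "card (neighbours T0 t) \<le> 3 * n"
        using card_neighbours_K_triples[OF T0_K_triples] t T0_K_triples by blast
      then have "real (card (neighbours T0 t)) \<le> 3 * real n" by linarith
      then show ?thesis using \<open>m \<le> 1\<close> b unfolding sum_constant by (intro mult_right_mono) auto
    qed
    ultimately show "\<bar>(\<Sum>u\<in>neighbours T0 t. y t - y u) - \<beta>\<bar> \<le> \<gamma> + 3 * real n * ((1 - m) * (2 * b))"
      using lap[OF t] by linarith
  qed
  then have "real n * b - 32 / 7 * (3 * real n * ((1 - m) * (2 * b))) \<le> 32 / 7 * \<gamma>"
    unfolding distrib_left by (simp only: diff_le_eq)
  moreover have "real n * b * (1 - 6 * (32 / 7) * (1 - m)) = real n * b - 32 / 7 * (3 * real n * ((1 - m) * (2 * b)))"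
    by algebra
  ultimately have "real n * b * (1 - 6 * (32 / 7) * (1 - m)) \<le> 32 / 7 * \<gamma>" by (simp only:)
  then have "real n * b \<le> 32 / 7 / (1 - 6 * (32 / 7) * (1 - m)) * \<gamma>"
    using pos_le_divide_eq[of "1 - 6 * (32 / 7) * (1 - m)" "real n * b" "32 / 7 * \<gamma>"] G(1) by simp
  also have "\<dots> \<le> G * \<gamma>" using G(2) \<gamma> by (rule mult_right_mono)
  finally show ?thesis .
qed

end

subsection \<open>The maximum principle\<close>

text \<open>At a maximum of \<open>\<Delta>\<close> all differences
  \<open>\<Delta> p - \<Delta> u\<close> are nonnegative, so only the old fluxes can balance
  \<open>\<mu> * \<Delta> p\<close>. Nonnegative weights suffice, so corrupted triangles are
  covered.\<close>

lemma max_principle_upper: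
  fixes W r :: "'a \<Rightarrow> 'a \<Rightarrow> real" and \<Delta> :: "'a \<Rightarrow> real"
  assumes "finite T" and nb: "\<And>t. t \<in> T \<Longrightarrow> nb t \<subseteq> T"
    and deg: "\<And>t. t \<in> T \<Longrightarrow> real (card (nb t)) \<le> d"
    and W: "\<And>t u. t \<in> T \<Longrightarrow> u \<in> nb t \<Longrightarrow> 0 \<le> W t u"
    and flux: "\<And>t u. t \<in> T \<Longrightarrow> u \<in> nb t \<Longrightarrow> - (W t u * r t u) \<le> k" and "0 \<le> k" and "0 < \<mu>"
    and eq: "\<And>t. t \<in> T \<Longrightarrow> (\<Sum>u\<in>nb t. W t u * (r t u + \<Delta> t - \<Delta> u)) + \<mu> * \<Delta> t = 0"
    and t: "t \<in> T"
  shows "\<mu> * \<Delta> t \<le> d * k"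
proof -
  have im: "finite (\<Delta> ` T)" "\<Delta> ` T \<noteq> {}" using assms(1) t by auto
  obtain p where p: "p \<in> T" "Max (\<Delta> ` T) = \<Delta> p" using Max_in[OF im] by auto
  have max: "\<Delta> u \<le> \<Delta> p" if "u \<in> T" for u
    using Max_ge[OF im(1), of "\<Delta> u"] that p(2) by simp
  have "\<mu> * \<Delta> t \<le> \<mu> * \<Delta> p" using max[OF t] \<open>0 < \<mu>\<close> by simp
  also have "\<dots> = (\<Sum>u\<in>nb p. - (W p u * (r p u + \<Delta> p - \<Delta> u)))"
    using eq[OF p(1)] by (simp add: sum_negf)
  also have "\<dots> \<le> (\<Sum>u\<in>nb p. k)"
  proof (rule sum_mono)
    fix u assume u: "u \<in> nb p"
    have "0 \<le> W p u * (\<Delta> p - \<Delta> u)" using W[OF p(1) u] max nb[OF p(1)] u by auto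
    then show "- (W p u * (r p u + \<Delta> p - \<Delta> u)) \<le> k"
      using flux[OF p(1) u] by (simp add: algebra_simps)
  qed
  also have "\<dots> \<le> d * k" unfolding sum_constant using deg[OF p(1)] \<open>0 \<le> k\<close> by (rule mult_right_mono)
  finally show ?thesis .
qed

lemma max_principle:
  fixes W r :: "'a \<Rightarrow> 'a \<Rightarrow> real" and \<Delta> :: "'a \<Rightarrow> real"
  assumes "finite T" and nb: "\<And>t. t \<in> T \<Longrightarrow> nb t \<subseteq> T"
    and deg: "\<And>t. t \<in> T \<Longrightarrow> real (card (nb t)) \<le> d"
    and W: "\<And>t u. t \<in> T \<Longrightarrow> u \<in> nb t \<Longrightarrow> 0 \<le> W t u"
    and flux: "\<And>t u. t \<in> T \<Longrightarrow> u \<in> nb t \<Longrightarrow> \<bar>W t u * r t u\<bar> \<le> k" and "0 \<le> k" and "0 < \<mu>"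
    and eq: "\<And>t. t \<in> T \<Longrightarrow> (\<Sum>u\<in>nb t. W t u * (r t u + \<Delta> t - \<Delta> u)) + \<mu> * \<Delta> t = 0"
    and t: "t \<in> T"
  shows "\<mu> * \<bar>\<Delta> t\<bar> \<le> d * k"
proof -
  have "\<mu> * \<Delta> t \<le> d * k"
    using assms(1) nb deg W _ \<open>0 \<le> k\<close> \<open>0 < \<mu>\<close> eq t
  proof (rule max_principle_upper)
    fix t u assume "t \<in> T" "u \<in> nb t"
    from flux[OF this] show "- (W t u * r t u) \<le> k" by linarith
  qed
  moreover have "\<mu> * (- \<Delta> t) \<le> d * k"
    using assms(1) nb deg W _ \<open>0 \<le> k\<close> \<open>0 < \<mu>\<close> _ t
  proof (rule max_principle_upper[where r = "\<lambda>t u. - r t u"])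
    fix t u assume "t \<in> T" "u \<in> nb t"
    from flux[OF this] show "- (W t u * - r t u) \<le> k" by simp
  next
    fix t assume "t \<in> T"
    have "(\<Sum>u\<in>nb t. W t u * (- r t u + - \<Delta> t - - \<Delta> u)) = - (\<Sum>u\<in>nb t. W t u * (r t u + \<Delta> t - \<Delta> u))"
      unfolding sum_negf[symmetric] by (simp add: algebra_simps)
    then show "(\<Sum>u\<in>nb t. W t u * (- r t u + - \<Delta> t - - \<Delta> u)) + \<mu> * - \<Delta> t = 0"
      using eq[OF \<open>t \<in> T\<close>] by simp
  qed
  ultimately show ?thesis by (cases "0 \<le> \<Delta> t") simp_all
qed

text \<open>\<open>X\<close> bounds the force of a corrupted row after a proximal step. It reappears on the right-hand side of
  its bound, because the corrupted forces contribute to the displacement of the clean triangles.\<close>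

lemma prox_constants:
  fixes a K G c s X :: real
  assumes "0 < a" "0 \<le> K" "32 / 7 \<le> G" "0 < c" "0 < s"
    and H: "12 * G * c * a + 6 * G * (K + a) * c * (1 + 48 * G * c) * (1 + 12 * G) < a / 2"
    and X: "X \<le> K * s * (1 + 12 * G) + 2 * a * s + 24 * G * c * X"
  shows "6 * G * c * X < a * s / 2"
proof -
  define q where "q = 24 * G * c"
  have G: "0 < G" "4 \<le> G" using assms(3) by linarith+
  have q: "0 < q" using G assms by (simp add: q_def)
  \<comment> \<open>This crude lower bound of the three factors, with \<open>4 \<le> G\<close>, lets
    the smallness condition yield \<open>q < 1/2\<close>.\<close>
  have "1 * 1 * (12 * 4) \<le> (K + a) / a * (1 + 48 * G * c) * (1 + 12 * G)"
    using assms G by (intro mult_mono) (auto simp: field_simps)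
  then have "6 * G * c * a * 48 \<le> 6 * G * c * a * ((K + a) / a * (1 + 48 * G * c) * (1 + 12 * G))"
    using assms G by (intro mult_left_mono) auto
  also have "\<dots> = 6 * G * (K + a) * c * (1 + 48 * G * c) * (1 + 12 * G)"
    using \<open>0 < a\<close> by (simp add: field_simps)
  also have "\<dots> < a / 2"
  proof -
    have "0 < 12 * G * c * a" using assms G by simp
    then show ?thesis using H by linarith
  qed
  finally have "a * (12 * q) < a / 2" by (simp add: q_def algebra_simps)
  then have q2: "q < 1 / 2" using \<open>0 < a\<close> q by simp
  have "X * (1 - q) \<le> s * (K * (1 + 12 * G) + 2 * a)"
    using X unfolding q_def by (simp add: algebra_simps)
  also have "\<dots> \<le> s * ((K + a) * (1 + 12 * G))"
    using assms G by (intro mult_left_mono) (auto simp: algebra_simps)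
  \<comment> \<open>For \<open>q \<le> 1/2\<close> the factor \<open>1 + 2 * q\<close> majorises
    \<open>1 / (1 - q)\<close>. Since \<open>2 * q = 48 * G * c\<close>, it is the factor
    \<open>1 + 12 * c / \<kappa>\<^sub>a\<close> of the smallness condition.\<close>
  also have "\<dots> \<le> s * ((K + a) * (1 + 12 * G)) * ((1 + 2 * q) * (1 - q))"
  proof -
    have "0 \<le> q * (1 - 2 * q)" using q q2 by simp
    then have "1 \<le> (1 + 2 * q) * (1 - q)" by (simp add: algebra_simps)
    moreover have "0 \<le> s * ((K + a) * (1 + 12 * G))" using assms G by simp
    ultimately show ?thesis
      using mult_left_mono[of 1 "(1 + 2 * q) * (1 - q)" "s * ((K + a) * (1 + 12 * G))"] by simp
  qed
  finally have "X * (1 - q) \<le> (s * ((K + a) * (1 + 12 * G)) * (1 + 2 * q)) * (1 - q)"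
    by (simp only: mult.assoc)
  then have "X \<le> s * ((K + a) * (1 + 12 * G)) * (1 + 2 * q)" using q2 by simp
  then have "6 * G * c * X \<le> 6 * G * c * (s * ((K + a) * (1 + 12 * G)) * (1 + 2 * q))"
    using assms G by (intro mult_left_mono) auto
  also have "\<dots> = s * (6 * G * (K + a) * c * (1 + 48 * G * c) * (1 + 12 * G))"
    unfolding q_def by algebra
  also have "\<dots> < s * (a / 2)"
  proof (intro mult_strict_left_mono)
    have "0 < 12 * G * c * a" using assms G by simp
    then show "6 * G * (K + a) * c * (1 + 48 * G * c) * (1 + 12 * G) < a / 2" using H by linarith
  qed (use assms in auto)
  finally show ?thesis by (simp add: mult.commute)
qed

subsection \<open>Diameter of the clean triangle graph\<close>

context clean_triangles
begin

text \<open>Two applications of \<open>common_neighbour\<close>, the second to \<open>A\<close> with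
  \<open>p\<close> added; hence \<open>7 = 6 + 1\<close>.\<close>

lemma clean_pair:
  assumes "real (card A) \<le> 6" "finite A" "A \<subseteq> {1..n}" "7 * (D + 1) < real n"
  obtains p q where "p \<in> {1..n}" "q \<in> {1..n}" "clean p q = 1"
    "\<forall>a\<in>A. clean a p = 1 \<and> clean a q = 1"
proof -
  have less: "real (card B) * (D + 1) < real (card {1..n})" if "card B \<le> 7" for B :: "nat set"
  proof -
    have "real (card B) * (D + 1) \<le> 7 * (D + 1)" using that defect_nonneg by (intro mult_right_mono) auto
    then show ?thesis using assms(4) by simp
  qed
  have "card A \<le> 7" using assms(1) by linarith
  from common_neighbour[OF assms(2,3) less[OF this]] obtain p
    where p: "p \<in> {1..n}" "\<forall>a\<in>A. clean a p = 1" by blast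
  have "card (insert p A) \<le> 7" using assms(1) card_insert_le_m1[of 7 A p] by simp
  from common_neighbour[OF _ _ less[OF this]] obtain q
    where "q \<in> {1..n}" "\<forall>a\<in>insert p A. clean a q = 1" using assms(2,3) p(1) by blast
  then show thesis using that[of p q] p by blast
qed

lemma T0_nonempty:
  assumes "7 * (D + 1) < real n"
  shows "T0 \<noteq> {}"
proof -
  have 1: "1 \<in> {1..n}" using n_pos by simp
  obtain p q where "p \<in> {1..n}" "q \<in> {1..n}" "clean p q = 1" "clean 1 p = 1" "clean 1 q = 1"
    using 1 assms by (elim clean_pair[of "{1}", rotated 3]) auto
  then have "tri 1 p q = 1" by (simp add: tri_def)
  then show ?thesis using tri_mem[of 1 p q] sort_triple_in_T0_iff[of 1 p q] by blast
qed

lemma adjacent_step: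
  fixes y :: "triangle \<Rightarrow> real"
  assumes step: "\<And>t u. t \<in> T0 \<Longrightarrow> u \<in> neighbours T0 t \<Longrightarrow> \<bar>y t - y u\<bar> \<le> R" and "0 \<le> R"
    and "tri i j k = 1" "tri i j l = 1"
  shows "\<bar>y (sort_triple i j k) - y (sort_triple i j l)\<bar> \<le> R"
proof (cases "sort_triple i j k = sort_triple i j l")
  case False
  have k: "sort_triple i j k \<in> T0" "sort_pair i j \<in> tri_edges (sort_triple i j k)"
    if "tri i j k = 1" for k
    using tri_mem[OF that] sort_triple_in_T0_iff[of i j k] that tri_edges_sort_triple[of i j k] by blast+
  show ?thesis using k[OF assms(3)] k[OF assms(4)] False by (intro step) (auto simp: neighbours_def)
qed (use assms in auto)

text \<open>With \<open>p\<close>, \<open>q\<close> joined to each other and to all six corners, the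
  path is \<open>ijk\<close>, \<open>ijp\<close>, \<open>ipq\<close>, \<open>lpq\<close>,
  \<open>lmp\<close>, \<open>lmr\<close>; consecutive triangles share the edges \<open>ij\<close>,
  \<open>ip\<close>, \<open>pq\<close>, \<open>lp\<close>, \<open>lm\<close>.\<close>

lemma clean_diameter:
  fixes y :: "triangle \<Rightarrow> real"
  assumes step: "\<And>t u. t \<in> T0 \<Longrightarrow> u \<in> neighbours T0 t \<Longrightarrow> \<bar>y t - y u\<bar> \<le> R" and "0 \<le> R"
    and n: "7 * (D + 1) < real n" and t: "t \<in> T0" and u: "u \<in> T0"
  shows "\<bar>y t - y u\<bar> \<le> 5 * R"
proof -
  obtain i j k where ijk: "t = (i, j, k)" "1 \<le> i" "i < j" "j < k" "k \<le> n"
    using t T0_K_triples by (auto simp: K_triples_def)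
  obtain l m r where lmr: "u = (l, m, r)" "1 \<le> l" "l < m" "m < r" "r \<le> n"
    using u T0_K_triples by (auto simp: K_triples_def)
  have st: "sort_triple i j k = t" "sort_triple l m r = u"
    using ijk lmr by (simp_all add: sort_triple_sorted)
  have tr: "tri i j k = 1" "tri l m r = 1"
    using sort_triple_in_T0_iff[of i j k] sort_triple_in_T0_iff[of l m r] ijk lmr t u st by simp_all
  define A where "A = set [i, j, k, l, m, r]"
  have "length [i, j, k, l, m, r] = 6" by simp
  then have A6: "real (card A) \<le> 6" unfolding A_def using card_length[of "[i, j, k, l, m, r]"] by linarith
  have A: "finite A" "A \<subseteq> {1..n}" using ijk lmr by (simp_all add: A_def)
  obtain p q where pq: "p \<in> {1..n}" "q \<in> {1..n}" "clean p q = 1" "\<forall>a\<in>A. clean a p = 1 \<and> clean a q = 1"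
    using clean_pair[OF A6 A n] .
  have ap: "clean a p = 1" "clean p a = 1" "clean a q = 1" "clean q a = 1" if "a \<in> A" for a
    using pq(4) that e_sym[of p a] e_sym[of q a] by simp_all
  have mem: "i \<in> A" "j \<in> A" "l \<in> A" "m \<in> A" by (simp_all add: A_def)
  note adj = ap[OF mem(1)] ap[OF mem(2)] ap[OF mem(3)] ap[OF mem(4)]
  have e: "clean i j = 1" "clean l m = 1"
    using tr e_cases[of i j] e_cases[of l m] by (auto simp: tri_def)
  have step': "\<bar>y (sort_triple i j k) - y (sort_triple i j l)\<bar> \<le> R"
    if "tri i j k = 1" "tri i j l = 1" for i j k l
    using step \<open>0 \<le> R\<close> that by (rule adjacent_step)
  have sw: "sort_triple i p j = sort_triple i j p" "sort_triple l p m = sort_triple l m p"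
    "sort_triple p q i = sort_triple i p q" "sort_triple p q l = sort_triple l p q"
    by (simp_all only: sort_triple_swap23[of i p j] sort_triple_swap23[of l p m]
        sort_triple_swap23[of p q i] sort_triple_swap23[of p q l]
        sort_triple_swap12[of p i] sort_triple_swap12[of p l])
  have "\<bar>y (sort_triple i j k) - y (sort_triple i j p)\<bar> \<le> R"
    by (rule step'[OF tr(1)]) (simp add: tri_def adj e)
  moreover have "\<bar>y (sort_triple i p j) - y (sort_triple i p q)\<bar> \<le> R"
    by (rule step') (simp_all add: tri_def adj e pq(3))
  moreover have "\<bar>y (sort_triple p q i) - y (sort_triple p q l)\<bar> \<le> R"
    by (rule step') (simp_all add: tri_def adj pq(3))
  moreover have "\<bar>y (sort_triple l p q) - y (sort_triple l p m)\<bar> \<le> R"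
    by (rule step') (simp_all add: tri_def adj e pq(3))
  moreover have "\<bar>y (sort_triple l m p) - y (sort_triple l m r)\<bar> \<le> R"
    by (rule step'[OF _ tr(2)]) (simp add: tri_def adj e)
  ultimately show ?thesis unfolding st sw abs_le_iff by linarith
qed

end

subsection \<open>Stationary points and proximal steps in the clean basin\<close>

context clean_triangles
begin

lemma sum_neighbours_split:
  fixes f :: "triangle \<Rightarrow> real"
  assumes "T0 \<subseteq> T" "T \<subseteq> K_triples n"
  shows "(\<Sum>u\<in>neighbours T t. f u) = (\<Sum>u\<in>neighbours T0 t. f u) + (\<Sum>u\<in>neighbours T t - T0. f u)"
proof -
  have "finite T" using assms(2) finite_K_triples finite_subset by blast
  then have "finite (neighbours T t)" by (simp add: neighbours_def)
  moreover have "neighbours T0 t \<subseteq> neighbours T t" using assms(1) by (auto simp: neighbours_def)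
  moreover have "neighbours T t - neighbours T0 t = neighbours T t - T0" by (auto simp: neighbours_def)
  ultimately show ?thesis using sum.subset_diff[of "neighbours T0 t" "neighbours T t" f] by simp
qed

lemma sum_corrupted_bound:
  fixes f :: "triangle \<Rightarrow> real"
  assumes "T \<subseteq> K_triples n" "t \<in> T0" "0 \<le> X"
    and "\<And>u. u \<in> neighbours T t \<Longrightarrow> \<bar>f u\<bar> \<le> X"
  shows "\<bar>\<Sum>u\<in>neighbours T t - T0. f u\<bar> \<le> 6 * D * X"
proof -
  have "\<bar>\<Sum>u\<in>neighbours T t - T0. f u\<bar> \<le> (\<Sum>u\<in>neighbours T t - T0. X)"
    by (rule order_trans[OF sum_abs sum_mono]) (use assms(4) in auto)
  also have "\<dots> \<le> 6 * D * X"
    unfolding sum_constant using card_corrupted_neighbours[OF assms(1,2)] assms(3) by (rule mult_right_mono)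
  finally show ?thesis .
qed

end

text \<open>One iterate in abstract form: \<open>W\<close> are the weights frozen there,
  \<open>r t u\<close> is the residual oriented out of \<open>t\<close>, and \<open>y\<close> is the
  deviation from the truth. Outside \<open>T0\<close> nothing is known but \<open>W\<close> in the
  unit interval and \<open>flux\<close>.\<close>

locale clean_basin = clean_triangles +
  fixes T :: "triangle set" and a m K G c s :: real
    and W r :: "triangle \<Rightarrow> triangle \<Rightarrow> real" and y :: "triangle \<Rightarrow> real"
  assumes T: "T0 \<subseteq> T" "T \<subseteq> K_triples n"
    and D_eq: "D = c * real n" and c: "0 < c" "c < 1 / 384" and n: "100 \<le> n"
    and K: "0 \<le> K" and s: "0 < s" and m: "m \<le> 1"
    and G: "6 * (32 / 7) * (1 - m) < 1" "32 / 7 / (1 - 6 * (32 / 7) * (1 - m)) \<le> G"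
    and W: "\<And>t u. t \<in> T \<Longrightarrow> u \<in> neighbours T t \<Longrightarrow> 0 \<le> W t u \<and> W t u \<le> 1"
    and flux: "\<And>t u. t \<in> T \<Longrightarrow> u \<in> neighbours T t \<Longrightarrow> \<bar>W t u * r t u\<bar> \<le> K * s"
    and W_clean: "\<And>t u. t \<in> T0 \<Longrightarrow> u \<in> neighbours T0 t \<Longrightarrow> \<bar>r t u\<bar> \<le> 2 * a * s \<Longrightarrow> m \<le> W t u"
    and r_clean: "\<And>t u. t \<in> T0 \<Longrightarrow> u \<in> neighbours T0 t \<Longrightarrow> r t u = y t - y u"
    and basin: "\<And>p q. p \<in> T0 \<Longrightarrow> q \<in> T0 \<Longrightarrow> y p - y q \<le> 2 * (a * s)"
begin

lemma neighbours_T: "u \<in> neighbours T0 t \<Longrightarrow> u \<in> neighbours T t" "u \<in> neighbours T0 t \<Longrightarrow> u \<in> T0"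
  using T(1) by (auto simp: neighbours_def)

lemma G_ge: "32 / 7 \<le> G"
proof -
  have "32 / 7 * (1 - 6 * (32 / 7) * (1 - m)) \<le> 32 / 7 * 1" using m by (intro mult_left_mono) auto
  then have "32 / 7 \<le> 32 / 7 / (1 - 6 * (32 / 7) * (1 - m))" using G(1) by (subst pos_le_divide_eq) auto
  then show ?thesis using G(2) by linarith
qed

lemma D_le: "D \<le> real n / 384"
  unfolding D_eq using mult_right_mono[of c "1 / 384" "real n"] c by simp

lemma green:
  fixes y' :: "triangle \<Rightarrow> real"
  assumes "\<And>t. t \<in> T0 \<Longrightarrow> \<bar>(\<Sum>u\<in>neighbours T0 t. W t u * (y' t - y' u)) - \<beta>\<bar> \<le> \<gamma>"
    and "\<And>t. t \<in> T0 \<Longrightarrow> \<bar>y' t - \<alpha>\<bar> \<le> b" "p \<in> T0" "q \<in> T0" "y' p - y' q = 2 * b"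
  shows "real n * b \<le> G * \<gamma>"
proof (rule clean_green_weighted[OF D_le n _ m G assms])
  fix t u assume tu: "t \<in> T0" "u \<in> neighbours T0 t"
  have "\<bar>r t u\<bar> \<le> 2 * a * s"
    unfolding r_clean[OF tu] using basin[of t u] basin[of u t] tu neighbours_T(2)[OF tu(2)] by simp
  then show "m \<le> W t u \<and> W t u \<le> 1"
    using W_clean[OF tu] W[of t u] tu T(1) neighbours_T(1)[OF tu(2)] by blast
qed

text \<open>The Green bound multiplies by \<open>G / n\<close>: the tolerance becomes
  \<open>M\<close>, and the corrupted force \<open>6 * c * n * K * s\<close> becomes
  \<open>6 * G * K * c * s\<close>. The stopping margin of the theorem is chosen so that the sum is
  \<open>a\<close> times the next scale.\<close>

lemma stationary_in_basin:
  assumes g: "\<And>t. t \<in> T0 \<Longrightarrow> \<bar>\<Sum>u\<in>neighbours T t. W t u * r t u\<bar> \<le> real n / G * M"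
    and pq: "p \<in> T0" "q \<in> T0"
  shows "y p - y q \<le> 2 * (M + 6 * G * K * c * s)"
proof -
  have fin: "finite T0" "T0 \<noteq> {}" using finite_T0 pq by auto
  obtain \<alpha> b p' q' where b: "p' \<in> T0" "q' \<in> T0" "y p' - y q' = 2 * b" and "\<forall>t\<in>T0. \<bar>y t - \<alpha>\<bar> \<le> b"
    using half_range[OF fin, of y] by blast
  then have b4: "\<bar>y t - \<alpha>\<bar> \<le> b" if "t \<in> T0" for t using that by blast
  have "real n * b \<le> G * (real n / G * M + 6 * D * (K * s))"
  proof (rule green[OF _ b4 b(1-3), where \<beta> = 0])
    fix t assume t: "t \<in> T0"
    have "(\<Sum>u\<in>neighbours T t. W t u * r t u)
        = (\<Sum>u\<in>neighbours T0 t. W t u * (y t - y u)) + (\<Sum>u\<in>neighbours T t - T0. W t u * r t u)"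
      unfolding sum_neighbours_split[OF T] using r_clean[OF t] by simp
    moreover have "\<bar>\<Sum>u\<in>neighbours T t - T0. W t u * r t u\<bar> \<le> 6 * D * (K * s)"
      using T t K s flux[of t] by (intro sum_corrupted_bound) auto
    ultimately show "\<bar>(\<Sum>u\<in>neighbours T0 t. W t u * (y t - y u)) - 0\<bar> \<le> real n / G * M + 6 * D * (K * s)"
      using g[OF t] by linarith
  qed auto
  also have "\<dots> = real n * (M + 6 * G * K * c * s)"
    using G_ge unfolding D_eq by (simp add: field_simps)
  finally have "b \<le> M + 6 * G * K * c * s" using n_pos by simp
  then have "2 * b \<le> 2 * (M + 6 * G * K * c * s)" by simp
  moreover have "y p - y q \<le> 2 * b" using b4[OF pq(1)] b4[OF pq(2)] by linarith
  ultimately show ?thesis by (rule order_trans[rotated])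
qed

lemma prox_step_in_basin:
  assumes a: "0 < a"
    and H: "12 * G * c * a + 6 * G * (K + a) * c * (1 + 48 * G * c) * (1 + 12 * G) < a / 2"
    and \<mu>: "\<mu> = real n / (4 * G)"
    and eq: "\<And>t. t \<in> T \<Longrightarrow> (\<Sum>u\<in>neighbours T t. W t u * (r t u + \<Delta> t - \<Delta> u)) + \<mu> * \<Delta> t = 0"
    and pq: "p \<in> T0" "q \<in> T0"
  shows "(y p + \<Delta> p) - (y q + \<Delta> q) \<le> 2 * (a * s)"
proof -
  have G0: "0 < G" using G_ge by linarith
  have N: "0 < real n" using n_pos by simp
  have \<mu>0: "0 < \<mu>" using G0 N by (simp add: \<mu>)
  have \<mu>G: "real n = 4 * G * \<mu>" using G0 by (simp add: \<mu>)
  have fin: "finite T0" "T0 \<noteq> {}" "finite T"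
    using finite_T0 pq T(2) finite_K_triples finite_subset by auto
  have KS: "0 \<le> K * s" using K s by simp
  define L where "L = 12 * G * (K * s)"
  have all: "\<bar>\<Delta> t\<bar> \<le> L" if "t \<in> T" for t
  proof -
    have "\<mu> * \<bar>\<Delta> t\<bar> \<le> (3 * real n) * (K * s)"
    proof (rule max_principle[OF fin(3) _ _ _ flux KS \<mu>0 eq that])
      fix t assume t: "t \<in> T"
      show "neighbours T t \<subseteq> T" by (auto simp: neighbours_def)
      have "card (neighbours T t) \<le> 3 * n" using T(2) t by (intro card_neighbours_K_triples) auto
      then show "real (card (neighbours T t)) \<le> 3 * real n" by linarith
    qed (use W in auto)
    also have "\<dots> = \<mu> * L" unfolding \<mu>G L_def by simp
    finally show ?thesis using \<mu>0 by simp
  qed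
  define y' where "y' t = y t + \<Delta> t" for t
  have im: "finite ((\<lambda>t. \<bar>\<Delta> t\<bar>) ` T0)" "(\<lambda>t. \<bar>\<Delta> t\<bar>) ` T0 \<noteq> {}" using fin by auto
  obtain td where td0: "td \<in> T0" "Max ((\<lambda>t. \<bar>\<Delta> t\<bar>) ` T0) = \<bar>\<Delta> td\<bar>" using Max_in[OF im] by auto
  have td: "\<bar>\<Delta> t\<bar> \<le> \<bar>\<Delta> td\<bar>" if "t \<in> T0" for t
    using Max_ge[OF im(1), of "\<bar>\<Delta> t\<bar>"] that td0(2) by simp
  define X where "X = K * s + L + \<bar>\<Delta> td\<bar>"
  have X0: "0 \<le> X" using KS G0 by (simp add: X_def L_def)
  define P where "P t = (\<Sum>u\<in>neighbours T t - T0. W t u * (r t u + \<Delta> t - \<Delta> u))" for t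
  have P: "\<bar>P t\<bar> \<le> 6 * D * X" if t: "t \<in> T0" for t
    unfolding P_def
  proof (rule sum_corrupted_bound[OF T(2) t X0])
    fix u assume u: "u \<in> neighbours T t"
    then have tu: "t \<in> T" "u \<in> T" using t T(1) by (auto simp: neighbours_def)
    have w: "0 \<le> W t u" "W t u \<le> 1" using W[OF tu(1) u] by auto
    have "\<bar>W t u * (\<Delta> t - \<Delta> u)\<bar> \<le> 1 * \<bar>\<Delta> t - \<Delta> u\<bar>"
      unfolding abs_mult using w by (intro mult_right_mono) auto
    also have "\<dots> \<le> \<bar>\<Delta> td\<bar> + L" using td[OF t] all[OF tu(2)] abs_triangle_ineq4[of "\<Delta> t" "\<Delta> u"] by simp
    finally have "\<bar>W t u * r t u + W t u * (\<Delta> t - \<Delta> u)\<bar> \<le> X"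
      using flux[OF tu(1) u] unfolding X_def by linarith
    then show "\<bar>W t u * (r t u + \<Delta> t - \<Delta> u)\<bar> \<le> X" by (simp add: algebra_simps)
  qed
  have eq': "(\<Sum>u\<in>neighbours T0 t. W t u * (y' t - y' u)) + P t + \<mu> * (y' t - y t) = 0" if t: "t \<in> T0" for t
  proof -
    have "(\<Sum>u\<in>neighbours T0 t. W t u * (y' t - y' u)) = (\<Sum>u\<in>neighbours T0 t. W t u * (r t u + \<Delta> t - \<Delta> u))"
    proof (rule sum.cong[OF refl])
      fix u assume "u \<in> neighbours T0 t"
      show "W t u * (y' t - y' u) = W t u * (r t u + \<Delta> t - \<Delta> u)"
        unfolding r_clean[OF t \<open>u \<in> neighbours T0 t\<close>] y'_def by (simp add: algebra_simps)
    qed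
    moreover have "t \<in> T" using t T(1) by auto
    ultimately show ?thesis
      using eq[OF \<open>t \<in> T\<close>] unfolding P_def sum_neighbours_split[OF T] by (simp add: y'_def)
  qed
  have Wc: "0 \<le> W t u" if "t \<in> T0" "u \<in> neighbours T0 t" for t u
    using W[of t u] that T(1) neighbours_T(1)[OF that(2)] by auto
  obtain \<alpha>' b' p' q' where b': "p' \<in> T0" "q' \<in> T0" "y' p' - y' q' = 2 * b'" and "\<forall>t\<in>T0. \<bar>y' t - \<alpha>'\<bar> \<le> b'"
    using half_range[OF fin(1,2), of y'] by blast
  then have b4: "\<bar>y' t - \<alpha>'\<bar> \<le> b'" if "t \<in> T0" for t using that by blast
  have max: "y' t \<le> y' p'" "y' q' \<le> y' t" if "t \<in> T0" for t
    using b4[OF that] b4[OF b'(1)] b4[OF b'(2)] b'(3) by linarith+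
  \<comment> \<open>At a maximum of \<open>y'\<close> the clean part of the step equation is
    nonnegative, so only corrupted forces can push this triangle upwards; the minimum is
    symmetric.\<close>
  have top: "\<mu> * (y' p' - y p') \<le> 6 * D * X"
  proof -
    have "0 \<le> (\<Sum>u\<in>neighbours T0 p'. W p' u * (y' p' - y' u))"
      using Wc[OF b'(1)] max neighbours_T(2) by (intro sum_nonneg) auto
    then show ?thesis using eq'[OF b'(1)] P[OF b'(1)] by linarith
  qed
  have bot: "- (6 * D * X) \<le> \<mu> * (y' q' - y q')"
  proof -
    have "(\<Sum>u\<in>neighbours T0 q'. W q' u * (y' q' - y' u)) \<le> 0"
      using Wc[OF b'(2)] max neighbours_T(2) by (intro sum_nonpos mult_nonneg_nonpos) auto
    then show ?thesis using eq'[OF b'(2)] P[OF b'(2)] by linarith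
  qed
  have scale: "6 * D * X = \<mu> * (24 * G * c * X)" unfolding D_eq \<mu>G by simp
  have top': "y' p' - y p' \<le> 24 * G * c * X" using top \<mu>0 unfolding scale by (simp only: mult_le_cancel_left_pos)
  have "\<mu> * (- (24 * G * c * X)) \<le> \<mu> * (y' q' - y q')"
    using bot unfolding scale mult_minus_right .
  then have bot': "- (24 * G * c * X) \<le> y' q' - y q'" using \<mu>0 by (simp only: mult_le_cancel_left_pos)
  \<comment> \<open>The new value at \<open>td\<close> is compared with the new extremum, that with
    the old value at the same triangle, and that with the old value at \<open>td\<close> through the
    basin.\<close>
  have "\<bar>\<Delta> td\<bar> \<le> 2 * (a * s) + 24 * G * c * X"
  proof (rule abs_leI)
    show "\<Delta> td \<le> 2 * (a * s) + 24 * G * c * X"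
      using top' max(1)[OF td0(1)] basin[OF b'(1) td0(1)] by (simp add: y'_def)
    show "- \<Delta> td \<le> 2 * (a * s) + 24 * G * c * X"
      using bot' max(2)[OF td0(1)] basin[OF td0(1) b'(2)] by (simp add: y'_def)
  qed
  then have "X \<le> K * s * (1 + 12 * G) + 2 * a * s + 24 * G * c * X"
    unfolding X_def L_def by (simp add: algebra_simps)
  then have small: "6 * G * c * X < a * s / 2"
    by (intro prox_constants[OF a K G_ge c(1) s H])
  obtain \<alpha> b u v where b: "u \<in> T0" "v \<in> T0" "y u - y v = 2 * b" "\<forall>t\<in>T0. \<bar>y t - \<alpha>\<bar> \<le> b"
    using half_range[OF fin(1,2), of y] by blast
  have \<alpha>: "\<bar>y t - \<alpha>\<bar> \<le> a * s" if "t \<in> T0" for t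
    using b(3) b(4) that basin[OF b(1,2)] by force
  \<comment> \<open>The proximal term splits into the constant
    \<open>\<mu> * (\<alpha> - \<alpha>')\<close>, absorbed as \<open>\<beta>\<close>, and a
    remainder bounded by the two half-ranges.\<close>
  have "real n * b' \<le> G * (6 * D * X + \<mu> * (a * s + b'))"
  proof (rule green[OF _ b4 b'(1-3), where \<beta> = "\<mu> * (\<alpha> - \<alpha>')"])
    fix t assume t: "t \<in> T0"
    have "(\<Sum>u\<in>neighbours T0 t. W t u * (y' t - y' u)) - \<mu> * (\<alpha> - \<alpha>') = \<mu> * ((y t - \<alpha>) - (y' t - \<alpha>')) - P t"
      using eq'[OF t] by (simp add: algebra_simps)
    moreover have "\<bar>\<mu> * ((y t - \<alpha>) - (y' t - \<alpha>'))\<bar> \<le> \<mu> * (a * s + b')"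
      unfolding abs_mult using \<mu>0 \<alpha>[OF t] b4[OF t] by (intro mult_mono) auto
    ultimately show "\<bar>(\<Sum>u\<in>neighbours T0 t. W t u * (y' t - y' u)) - \<mu> * (\<alpha> - \<alpha>')\<bar> \<le> 6 * D * X + \<mu> * (a * s + b')"
      using P[OF t] by linarith
  qed auto
  also have "\<dots> = real n * (6 * G * c * X + (a * s + b') / 4)"
    unfolding D_eq \<mu>G by (simp add: algebra_simps)
  finally have "b' \<le> 6 * G * c * X + (a * s + b') / 4" using N by simp
  \<comment> \<open>The budget is exact: \<open>w < v / 2\<close> and \<open>v / 4\<close> leave
    \<open>3/4 * v\<close> for \<open>3/4 * b\<close>.\<close>
  moreover have "b \<le> v" if "b \<le> w + (v + b) / 4" "w < v / 2" for b v w :: real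
    using that by (simp add: field_simps)
  ultimately have "b' \<le> a * s" using small by blast
  then have "2 * b' \<le> 2 * (a * s)" by simp
  moreover have "(y p + \<Delta> p) - (y q + \<Delta> q) \<le> 2 * b'"
    using b4[OF pq(1)] b4[OF pq(2)] unfolding y'_def by linarith
  ultimately show ?thesis by (rule order_trans[rotated])
qed

end

subsection \<open>Scales and residuals of clean triangles\<close>

text \<open>This is the law of sines. The edge vectors \<open>u\<close>, \<open>v\<close>,
  \<open>w\<close> sum to zero, so their cyclic cross products agree; \<open>tri_h\<close> is the
  sine of the opposite angle, and the scale is the diameter of the circumscribed circle.\<close>

lemma true_scale:
  assumes model: "camera_model n x E0 Eb d" and t: "t \<in> clean_triples n E0"
  shows "0 < true_scale x d t" "\<And>e. e \<in> tri_edges t \<Longrightarrow> true_scale x d t * tri_h d t e = edge_len x e"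
proof -
  obtain i j k where ijk: "t = (i, j, k)" "1 \<le> i" "i < j" "j < k" "k \<le> n"
    and E0: "(i, j) \<in> E0" "(j, k) \<in> E0" "(i, k) \<in> E0"
    using t by (auto simp: clean_triples_def K_triples_def)
  define u v w where "u = x i - x j" and "v = x j - x k" and "w = x k - x i"
  have all: "\<forall>(i, j)\<in>E0. d i j = (x i - x j) /\<^sub>R edge_len x (i, j)"
    using model unfolding camera_model_def by (elim conjE)
  have dir: "d i j = (x i - x j) /\<^sub>R norm (x i - x j)" if "(i, j) \<in> E0" for i j
    using bspec[OF all that] by simp
  have "\<forall>i\<in>{1..n}. \<forall>j\<in>{1..n}. i \<noteq> j \<longrightarrow> norm (d i j) = 1 \<and> d j i = - d i j"
    using model unfolding camera_model_def by (elim conjE)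
  moreover have "i \<in> {1..n}" "k \<in> {1..n}" "i \<noteq> k" using ijk by simp_all
  ultimately have ki: "d k i = - d i k" by blast
  have "x i - x k = - w" by (simp add: w_def)
  then have "d i k = - (w /\<^sub>R norm w)" unfolding dir[OF E0(3)] by simp
  then have d: "d i j = u /\<^sub>R norm u" "d j k = v /\<^sub>R norm v" "d k i = w /\<^sub>R norm w"
    using dir[OF E0(1)] dir[OF E0(2)] ki by (simp_all add: u_def v_def)
  have w: "w = - u + - v" by (simp add: u_def v_def w_def)
  have cr: "cross3 v w = cross3 u v" "cross3 w u = cross3 u v"
    unfolding w cross_add_left cross_add_right cross_minus_left cross_minus_right cross_skew[of v u] by simp_all
  define A where "A = norm (cross3 u v)"
  have h: "tri_h d t (i, j) = A / (norm v * norm w)" "tri_h d t (j, k) = A / (norm w * norm u)"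
    "tri_h d t (i, k) = A / (norm u * norm v)"
    using ijk by (simp_all add: d cross_mult_left cross_mult_right cr A_def divide_inverse)
  have edges: "tri_edges t = {(i, j), (j, k), (i, k)}" by (simp add: ijk)
  have pos: "0 < tri_h d t (i, j)"
    using model t edges unfolding camera_model_def nondegenerate_def by blast
  then have nz: "0 < A" "0 < norm v" "0 < norm w"
    unfolding h by (auto simp: zero_less_divide_iff A_def zero_less_mult_iff)
  have pos': "0 < tri_h d t (j, k)"
    using model t edges unfolding camera_model_def nondegenerate_def by blast
  then have nz': "0 < norm u"
    unfolding h by (auto simp: zero_less_divide_iff A_def zero_less_mult_iff)
  define s where "s = norm u * norm v * norm w / A"
  have len: "edge_len x (i, j) = norm u" "edge_len x (j, k) = norm v" "edge_len x (i, k) = norm w"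
    by (simp_all add: u_def v_def w_def norm_minus_commute)
  have s: "0 < s \<and> (\<forall>e\<in>tri_edges t. s * tri_h d t e = edge_len x e)"
    unfolding edges using nz nz' by (auto simp: s_def h len simp del: tri_h.simps edge_len.simps)
  moreover have "s' = s" if "0 < s' \<and> (\<forall>e\<in>tri_edges t. s' * tri_h d t e = edge_len x e)" for s'
  proof -
    have "s' * tri_h d t (i, j) = s * tri_h d t (i, j)" using that s edges by simp
    then show ?thesis using pos by simp
  qed
  ultimately have "true_scale x d t = s" unfolding true_scale_def by (rule the_equality)
  then show "0 < true_scale x d t" "\<And>e. e \<in> tri_edges t \<Longrightarrow> true_scale x d t * tri_h d t e = edge_len x e"
    using s by auto
qed

lemma shared_edge_mem:
  assumes "t \<in> K_triples n" "u \<in> K_triples n" "t \<noteq> u" "tri_edges t \<inter> tri_edges u \<noteq> {}"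
  shows "shared_edge t u \<in> tri_edges t" "shared_edge t u \<in> tri_edges u"
proof -
  obtain e where e: "e \<in> tri_edges t" "e \<in> tri_edges u" using assms(4) by blast
  then have "tri_edges t \<inter> tri_edges u = {e}"
    using common_edge_unique[OF assms(1-3) e] by blast
  then show "shared_edge t u \<in> tri_edges t" "shared_edge t u \<in> tri_edges u"
    using e by (simp_all add: shared_edge_def)
qed

text \<open>Both clean triangles assign the true length to the common edge, so the logarithm of the
  ratio equals the difference of the true log-scales.\<close>

lemma clean_row_residual:
  assumes model: "camera_model n x E0 Eb d"
    and t: "t \<in> clean_triples n E0" and u: "u \<in> clean_triples n E0"
    and tu: "t \<noteq> u" "tri_edges t \<inter> tri_edges u \<noteq> {}"
  shows "row_residual d (t, u) z = (z u - true_log_scale x d u) - (z t - true_log_scale x d t)"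
proof -
  let ?e = "shared_edge t u"
  have e: "?e \<in> tri_edges t" "?e \<in> tri_edges u"
    using shared_edge_mem[of t n u] t u tu by (simp_all add: clean_triples_def)
  have pos: "0 < tri_h d t ?e" "0 < tri_h d u ?e"
    using model t u e unfolding camera_model_def nondegenerate_def by blast+
  have st: "0 < true_scale x d t" "0 < true_scale x d u"
    using true_scale(1)[OF model] t u by blast+
  have "true_scale x d t * tri_h d t ?e = true_scale x d u * tri_h d u ?e"
    using true_scale(2)[OF model t e(1)] true_scale(2)[OF model u e(2)] by simp
  then have "tri_h d t ?e / tri_h d u ?e = true_scale x d u / true_scale x d t"
    using pos st by (simp add: frac_eq_eq mult.commute)
  then have "ln (tri_h d t ?e / tri_h d u ?e) = true_log_scale x d u - true_log_scale x d t"
    using st by (simp add: true_log_scale_def ln_div)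
  then show ?thesis by simp
qed

subsection \<open>Rows at a triangle\<close>

text \<open>This is the orientation of the pair that \<open>C\<close> contains. Multiplying by
  \<open>incidence\<close> at \<open>t\<close> removes the dependence on the orientation.\<close>

definition row_of :: "row set \<Rightarrow> triangle \<Rightarrow> triangle \<Rightarrow> row" where
  "row_of C t u = (if (u, t) \<in> C then (u, t) else (t, u))"

lemma row_of_mem:
  assumes "is_row_set T C" "t \<in> T" "u \<in> neighbours T t"
  shows "row_of C t u \<in> C"
  using assms unfolding is_row_set_def neighbours_def row_of_def by auto

lemma finite_row_set:
  assumes "is_row_set T C" "finite T"
  shows "finite C"
proof (rule finite_subset)
  show "C \<subseteq> T \<times> T" using assms(1) unfolding is_row_set_def by auto
qed (use assms in auto)

lemma incidence_row_of:
  assumes "t \<noteq> u"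
  shows "incidence (row_of C t u) t = (if (u, t) \<in> C then 1 else -1)"
  using assms by (simp add: row_of_def)

text \<open>An entry of the transposed incidence matrix sees only the rows at \<open>t\<close>, and
  these correspond bijectively to the neighbours of \<open>t\<close>.\<close>

lemma sum_rows:
  fixes s :: "row \<Rightarrow> real"
  assumes C: "is_row_set T C" and "finite T" and t: "t \<in> T"
  shows "(\<Sum>f\<in>C. incidence f t * s f)
    = (\<Sum>u\<in>neighbours T t. incidence (row_of C t u) t * s (row_of C t u))"
proof -
  let ?R = "{f \<in> C. fst f = t \<or> snd f = t}"
  have rows: "a \<in> T" "b \<in> T" "a \<noteq> b" "tri_edges a \<inter> tri_edges b \<noteq> {}" "(b, a) \<notin> C" if "(a, b) \<in> C" for a b
  proof -
    show 1: "a \<in> T" "b \<in> T" "a \<noteq> b" "tri_edges a \<inter> tri_edges b \<noteq> {}"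
      using C that unfolding is_row_set_def by auto
    then show "(b, a) \<notin> C" using C that unfolding is_row_set_def by blast
  qed
  have "bij_betw (row_of C t) (neighbours T t) ?R"
  proof (rule bij_betwI')
    fix u v assume "u \<in> neighbours T t" "v \<in> neighbours T t"
    then show "(row_of C t u = row_of C t v) = (u = v)"
      by (auto simp: row_of_def neighbours_def)
  next
    fix u assume "u \<in> neighbours T t"
    then show "row_of C t u \<in> ?R" using row_of_mem[OF C t] by (auto simp: row_of_def)
  next
    fix f assume f: "f \<in> ?R"
    obtain a b where ab: "f = (a, b)" by (cases f)
    show "\<exists>u\<in>neighbours T t. f = row_of C t u"
    proof (cases "a = t")
      case True
      then have "b \<in> neighbours T t" "f = row_of C t b"
        using f rows[of a b] by (auto simp: ab neighbours_def row_of_def)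
      then show ?thesis by blast
    next
      case False
      then have "b = t" using f ab by auto
      then have "a \<in> neighbours T t" "f = row_of C t a"
        using f rows[of a b] by (auto simp: ab neighbours_def row_of_def)
      then show ?thesis by blast
    qed
  qed
  then have "(\<Sum>u\<in>neighbours T t. incidence (row_of C t u) t * s (row_of C t u)) = (\<Sum>f\<in>?R. incidence f t * s f)"
    by (rule sum.reindex_bij_betw)
  also have "\<dots> = (\<Sum>f\<in>C. incidence f t * s f)"
  proof (rule sum.mono_neutral_left)
    show "finite C" using finite_row_set[OF C \<open>finite T\<close>] .
    show "\<forall>f\<in>C - ?R. incidence f t * s f = 0"
    proof
      fix f assume f: "f \<in> C - ?R"
      obtain a b where "f = (a, b)" by (cases f)
      moreover from this f have "t \<noteq> a" "t \<noteq> b" by auto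
      ultimately show "incidence f t * s f = 0" by simp
    qed
  qed auto
  finally show ?thesis by simp
qed

lemma row_of_residual_diff:
  assumes "t \<noteq> u"
  shows "incidence (row_of C t u) t * row_residual d (row_of C t u) z'
    = incidence (row_of C t u) t * row_residual d (row_of C t u) z + (z' t - z t) - (z' u - z u)"
  using assms by (simp add: row_of_def)

subsection \<open>Proximal steps\<close>

text \<open>The first-order condition without derivatives: with \<open>k > A\<close> the trial value
  \<open>- B / k\<close> makes the linear term outweigh the quadratic one.\<close>

lemma linear_coefficient_zero:
  fixes A B :: real
  assumes "\<And>\<epsilon>. 0 \<le> \<epsilon> * B + \<epsilon>\<^sup>2 * A"
  shows "B = 0"
proof (rule ccontr)
  assume "B \<noteq> 0"
  define k where "k = \<bar>A\<bar> + 1"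
  have k: "0 < k" "A < k" by (simp_all add: k_def)
  have "0 \<le> (- B / k) * B + (- B / k)\<^sup>2 * A" by (rule assms)
  also have "\<dots> = - (B\<^sup>2 / k) * (1 - A / k)"
    using k by (simp add: power2_eq_square field_simps)
  also have "\<dots> < 0" using k \<open>B \<noteq> 0\<close> by (intro mult_neg_pos) auto
  finally show False by simp
qed

lemma row_residual_update:
  assumes "fst f \<noteq> snd f"
  shows "row_residual d f (z(t := z t + \<epsilon>)) = row_residual d f z + \<epsilon> * incidence f t"
  using assms by (cases f) auto

text \<open>Along a single coordinate the objective is quadratic in \<open>\<epsilon>\<close>, so
  its linear coefficient vanishes at the minimiser.\<close>

lemma prox_stationary:
  assumes C: "is_row_set T C" and "finite T" and t: "t \<in> T"
    and min: "is_arg_min (prox_objective d \<pi> T C \<mu> wt z) (\<lambda>y. y \<in> T \<rightarrow>\<^sub>E UNIV) z'"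
  shows "(\<Sum>f\<in>C. incidence f t * (base_weight \<pi> f * wt f * row_residual d f z')) + \<mu> * (z' t - z t) = 0"
proof (rule linear_coefficient_zero)
  fix \<epsilon> :: real
  let ?y = "z'(t := z' t + \<epsilon>)"
  let ?c = "\<lambda>f. base_weight \<pi> f * wt f"
  let ?A = "1/2 * (\<Sum>f\<in>C. ?c f * (incidence f t)\<^sup>2) + \<mu> / 2"
  have "?y \<in> T \<rightarrow>\<^sub>E UNIV" using min t by (auto simp: is_arg_min_def PiE_def extensional_def)
  then have le: "prox_objective d \<pi> T C \<mu> wt z z' \<le> prox_objective d \<pi> T C \<mu> wt z ?y"
    using min by (auto simp: is_arg_min_def not_less)
  have rows: "(\<Sum>f\<in>C. ?c f * (row_residual d f ?y)\<^sup>2) =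
      (\<Sum>f\<in>C. ?c f * (row_residual d f z')\<^sup>2)
      + 2 * \<epsilon> * (\<Sum>f\<in>C. incidence f t * (?c f * row_residual d f z')) + \<epsilon>\<^sup>2 * (\<Sum>f\<in>C. ?c f * (incidence f t)\<^sup>2)"
    unfolding sum_distrib_left sum.distrib[symmetric]
  proof (rule sum.cong[OF refl])
    fix f assume "f \<in> C"
    then have "fst f \<noteq> snd f" using C unfolding is_row_set_def by fastforce
    then show "?c f * (row_residual d f ?y)\<^sup>2 = ?c f * (row_residual d f z')\<^sup>2
        + 2 * \<epsilon> * (incidence f t * (?c f * row_residual d f z')) + \<epsilon>\<^sup>2 * (?c f * (incidence f t)\<^sup>2)"
      unfolding row_residual_update[OF \<open>fst f \<noteq> snd f\<close>] by (simp add: power2_eq_square algebra_simps)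
  qed
  have "(\<Sum>s\<in>T. (?y s - z s)\<^sup>2) = (?y t - z t)\<^sup>2 + (\<Sum>s\<in>T - {t}. (?y s - z s)\<^sup>2)"
    using \<open>finite T\<close> t by (rule sum.remove)
  moreover have "(\<Sum>s\<in>T. (z' s - z s)\<^sup>2) = (z' t - z t)\<^sup>2 + (\<Sum>s\<in>T - {t}. (z' s - z s)\<^sup>2)"
    using \<open>finite T\<close> t by (rule sum.remove)
  moreover have "(\<Sum>s\<in>T - {t}. (?y s - z s)\<^sup>2) = (\<Sum>s\<in>T - {t}. (z' s - z s)\<^sup>2)"
    by (intro sum.cong) auto
  ultimately have prox: "(\<Sum>s\<in>T. (?y s - z s)\<^sup>2) = (\<Sum>s\<in>T. (z' s - z s)\<^sup>2) + 2 * \<epsilon> * (z' t - z t) + \<epsilon>\<^sup>2"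
    by (simp add: power2_eq_square algebra_simps)
  have "prox_objective d \<pi> T C \<mu> wt z ?y - prox_objective d \<pi> T C \<mu> wt z z'
    = \<epsilon> * ((\<Sum>f\<in>C. incidence f t * (?c f * row_residual d f z')) + \<mu> * (z' t - z t)) + \<epsilon>\<^sup>2 * ?A"
    unfolding prox_objective_def rows prox by (simp add: algebra_simps add_divide_distrib)
  then show "0 \<le> \<epsilon> * ((\<Sum>f\<in>C. incidence f t * (?c f * row_residual d f z')) + \<mu> * (z' t - z t)) + \<epsilon>\<^sup>2 * ?A"
    using le by linarith
qed

text \<open>By (R2) the weighted squares majorise the loss with contact at \<open>z\<close>; the
  minimiser is compared with \<open>z\<close> itself, where the proximal term is zero.\<close>

lemma prox_descent:
  assumes "finite C" and bw: "\<And>f. f \<in> C \<Longrightarrow> 0 \<le> base_weight \<pi> f"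
    and sel: "\<And>f. f \<in> C \<Longrightarrow> admissible_selection \<rho> s a m K (\<omega> f)"
    and z: "z \<in> T \<rightarrow>\<^sub>E UNIV"
    and min: "is_arg_min (prox_objective d \<pi> T C \<mu> (\<lambda>f. \<omega> f (row_residual d f z)) z) (\<lambda>y. y \<in> T \<rightarrow>\<^sub>E UNIV) z'"
  shows "(\<Sum>f\<in>C. base_weight \<pi> f * \<rho> (row_residual d f z')) + \<mu> / 2 * (\<Sum>t\<in>T. (z' t - z t)\<^sup>2)
    \<le> (\<Sum>f\<in>C. base_weight \<pi> f * \<rho> (row_residual d f z))"
proof -
  let ?r = "\<lambda>f. row_residual d f z" and ?r' = "\<lambda>f. row_residual d f z'"
  have maj: "base_weight \<pi> f * \<rho> (?r' f) \<le> base_weight \<pi> f * \<rho> (?r f)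
      + (1/2 * (base_weight \<pi> f * \<omega> f (?r f) * (?r' f)\<^sup>2) - 1/2 * (base_weight \<pi> f * \<omega> f (?r f) * (?r f)\<^sup>2))"
    if f: "f \<in> C" for f
  proof -
    have "\<rho> (?r' f) \<le> \<rho> (?r f) + 1/2 * \<omega> f (?r f) * ((?r' f)\<^sup>2 - (?r f)\<^sup>2)"
      using sel[OF f] unfolding admissible_selection_def MM_selector_def by auto
    from mult_left_mono[OF this bw[OF f]] show ?thesis by (simp add: algebra_simps)
  qed
  have "prox_objective d \<pi> T C \<mu> (\<lambda>f. \<omega> f (?r f)) z z' \<le> prox_objective d \<pi> T C \<mu> (\<lambda>f. \<omega> f (?r f)) z z"
    using min z by (auto simp: is_arg_min_def not_less)
  moreover have "(\<Sum>f\<in>C. base_weight \<pi> f * \<rho> (?r' f)) \<le> (\<Sum>f\<in>C. base_weight \<pi> f * \<rho> (?r f)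
      + (1/2 * (base_weight \<pi> f * \<omega> f (?r f) * (?r' f)\<^sup>2) - 1/2 * (base_weight \<pi> f * \<omega> f (?r f) * (?r f)\<^sup>2)))"
    by (rule sum_mono) (rule maj)
  ultimately show ?thesis
    unfolding prox_objective_def sum.distrib sum_subtractf sum_distrib_left[symmetric] by simp
qed

text \<open>Otherwise \<open>F\<close> would drop by more than \<open>\<mu> * \<epsilon>\<close> at
  every step and become negative. One good index is enough for a stopping rule.\<close>

lemma small_term_if_bounded_sums:
  fixes F S :: "nat \<Rightarrow> real"
  assumes "0 < \<mu>" "\<And>j. 0 \<le> F j" "\<And>j. F (Suc j) + \<mu> * S j \<le> F j" "0 < \<epsilon>"
  shows "\<exists>j. S j \<le> \<epsilon>"
proof (rule ccontr)
  assume "\<not> ?thesis"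
  then have big: "\<epsilon> < S j" for j by (simp add: not_le)
  have dec: "F j \<le> F 0 - real j * (\<mu> * \<epsilon>)" for j
  proof (induction j)
    case (Suc j)
    have "\<mu> * \<epsilon> \<le> \<mu> * S j" using big[of j] \<open>0 < \<mu>\<close> by simp
    then show ?case using Suc assms(3)[of j] by (simp add: algebra_simps)
  qed simp
  have "0 < \<mu> * \<epsilon>" using assms by simp
  then obtain j where "F 0 < real j * (\<mu> * \<epsilon>)" using reals_Archimedean3 by blast
  then show False using dec[of j] assms(2)[of j] by linarith
qed

subsection \<open>Orbits and continuation in the scale\<close>

locale camera_run = clean_triangles n E0 Eb "c * real n" for n E0 Eb c +
  fixes x :: "nat \<Rightarrow> real^3" and d :: "nat \<Rightarrow> nat \<Rightarrow> real^3" and \<pi> :: "triangle \<Rightarrow> real"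
    and C :: "row set" and a m K G :: real
  assumes model: "camera_model n x E0 Eb d"
    and scores: "reliability_scores (retained_triangles n d) (clean_triples n E0) \<pi>"
    and rows: "is_row_set (retained_triangles n d) C"
    and a: "0 < a" and m: "m \<le> 1" and K: "0 \<le> K" and n: "100 \<le> n" and c: "0 < c" "c < 1 / 384"
    and G: "6 * (32 / 7) * (1 - m) < 1" "32 / 7 / (1 - 6 * (32 / 7) * (1 - m)) \<le> G"
    and H: "12 * G * c * a + 6 * G * (K + a) * c * (1 + 48 * G * c) * (1 + 12 * G) < a / 2"
begin

abbreviation T :: "triangle set" where
  "T \<equiv> retained_triangles n d"

definition deviation :: "(triangle \<Rightarrow> real) \<Rightarrow> triangle \<Rightarrow> real" where
  "deviation z t = z t - true_log_scale x d t"

text \<open>The basin in terms of differences: the spread is twice the half-range, so neither a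
  centre nor an infimum is carried through the induction.\<close>

definition in_basin :: "real \<Rightarrow> (triangle \<Rightarrow> real) \<Rightarrow> bool" where
  "in_basin v z \<longleftrightarrow> (\<forall>p\<in>T0. \<forall>q\<in>T0. deviation z p - deviation z q \<le> 2 * v)"

definition weight :: "(row \<Rightarrow> real \<Rightarrow> real) \<Rightarrow> (triangle \<Rightarrow> real) \<Rightarrow> triangle \<Rightarrow> triangle \<Rightarrow> real" where
  "weight \<omega> z t u = base_weight \<pi> (row_of C t u) * \<omega> (row_of C t u) (row_residual d (row_of C t u) z)"

definition outflow :: "(triangle \<Rightarrow> real) \<Rightarrow> triangle \<Rightarrow> triangle \<Rightarrow> real" where
  "outflow z t u = incidence (row_of C t u) t * row_residual d (row_of C t u) z"

lemma T_K_triples: "T \<subseteq> K_triples n"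
  by (auto simp: retained_triangles_def)

lemma T0_T: "T0 \<subseteq> T"
proof
  fix t assume t: "t \<in> T0"
  have "\<forall>t\<in>T0. nondegenerate d t" using model unfolding camera_model_def by (elim conjE)
  then show "t \<in> T" using t T0_K_triples by (auto simp: retained_triangles_def)
qed

lemma finite_T: "finite T"
  using T_K_triples finite_K_triples finite_subset by blast

lemma seven_D: "7 * (c * real n + 1) < real n"
proof -
  have "c * real n \<le> 1 / 384 * real n" using c by (intro mult_right_mono) auto
  moreover have "100 \<le> real n" using n by simp
  moreover have "7 * (y + 1) < N" if "y \<le> 1 / 384 * N" "100 \<le> N" for y N :: real
    using that by (simp add: field_simps)
  ultimately show ?thesis by blast
qed

lemma T_nonempty: "T0 \<noteq> {}" "T \<noteq> {}"
  using T0_nonempty[OF seven_D] T0_T by auto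

lemma neighbours_neq: "u \<in> neighbours A t \<Longrightarrow> t \<noteq> u"
  by (auto simp: neighbours_def)

lemma row_cases:
  assumes "f \<in> C"
  obtains t u where "f = (t, u)" "t \<in> T" "u \<in> T"
proof -
  obtain t u where "f = (t, u)" by (cases f)
  moreover from this have "t \<in> T" "u \<in> T" using assms rows unfolding is_row_set_def by auto
  ultimately show thesis by (rule that)
qed

lemma base_weight_bounds:
  assumes "f \<in> C"
  shows "0 \<le> base_weight \<pi> f" "base_weight \<pi> f \<le> 1"
proof -
  obtain t u where f: "f = (t, u)" "t \<in> T" "u \<in> T" using row_cases[OF assms] .
  then have "0 \<le> \<pi> t" "\<pi> t \<le> 1" "0 \<le> \<pi> u" "\<pi> u \<le> 1" using scores unfolding reliability_scores_def by auto
  then show "0 \<le> base_weight \<pi> f" "base_weight \<pi> f \<le> 1" by (simp_all add: f mult_le_one)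
qed

lemma base_weight_clean:
  assumes "t \<in> T0" "u \<in> T0"
  shows "base_weight \<pi> (row_of C t u) = 1"
  using assms scores unfolding reliability_scores_def by (simp add: row_of_def)

lemma abs_outflow:
  assumes "t \<noteq> u"
  shows "\<bar>outflow z t u\<bar> = \<bar>row_residual d (row_of C t u) z\<bar>"
  unfolding outflow_def incidence_row_of[OF assms] by simp

lemma outflow_clean:
  assumes "t \<in> T0" "u \<in> neighbours T0 t"
  shows "outflow z t u = deviation z t - deviation z u"
proof -
  have u: "u \<in> T0" "t \<noteq> u" "tri_edges t \<inter> tri_edges u \<noteq> {}" "tri_edges u \<inter> tri_edges t \<noteq> {}"
    using assms(2) by (auto simp: neighbours_def)
  show ?thesis
  proof (cases "(u, t) \<in> C")
    case True
    then show ?thesis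
      using clean_row_residual[OF model u(1) assms(1) u(2)[symmetric] u(4), of z] u(2)
      unfolding outflow_def incidence_row_of[OF u(2)] deviation_def by (simp only: row_of_def) simp
  next
    case False
    then show ?thesis
      using clean_row_residual[OF model assms(1) u(1) u(2) u(3), of z] u(2)
      unfolding outflow_def incidence_row_of[OF u(2)] deviation_def by (simp only: row_of_def) simp
  qed
qed

lemma stationarity_residual_eq:
  assumes "t \<in> T"
  shows "stationarity_residual d \<pi> C \<omega> z t = (\<Sum>u\<in>neighbours T t. weight \<omega> z t u * outflow z t u)"
  unfolding stationarity_residual_def sum_rows[OF rows finite_T assms] weight_def outflow_def
  by (simp only: mult_ac)

text \<open>Selector properties (R3) and (R4) become \<open>W_clean\<close> and \<open>flux\<close>.
  The lower bound survives because base weights of clean rows equal 1, the upper bound because all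
  base weights are at most 1.\<close>

lemma basin_step:
  assumes sel: "\<forall>f\<in>C. admissible_selection \<rho> s a m K (\<omega> f)" and s: "0 < s" and basin: "in_basin (a * s) z"
  shows "clean_basin n E0 Eb (c * real n) T a m K G c s (weight \<omega> z) (outflow z) (deviation z)"
proof unfold_locales
  have sel': "0 \<le> \<omega> f r" "\<omega> f r \<le> 1" "\<bar>r\<bar> \<le> 2 * a * s \<Longrightarrow> m \<le> \<omega> f r" "\<bar>\<omega> f r * r\<bar> \<le> K * s" if "f \<in> C" for f r
    using bspec[OF sel that] unfolding admissible_selection_def MM_selector_def by blast+
  note row = row_of_mem[OF rows]
  show "T0 \<subseteq> T" by (rule T0_T)
  show "T \<subseteq> K_triples n" by (rule T_K_triples)
  show "c * real n = c * real n" ..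
  show "0 < c" "c < 1 / 384" "100 \<le> n" "0 \<le> K" "0 < s" "m \<le> 1" by (fact c n K s m)+
  show "6 * (32 / 7) * (1 - m) < 1" "32 / 7 / (1 - 6 * (32 / 7) * (1 - m)) \<le> G" by (fact G)+
  fix t u
  show "0 \<le> weight \<omega> z t u \<and> weight \<omega> z t u \<le> 1" if "t \<in> T" "u \<in> neighbours T t"
    unfolding weight_def using base_weight_bounds[OF row[OF that]] sel'(1,2)[OF row[OF that]]
    by (simp add: mult_le_one)
  show "\<bar>weight \<omega> z t u * outflow z t u\<bar> \<le> K * s" if "t \<in> T" "u \<in> neighbours T t"
  proof -
    let ?f = "row_of C t u"
    have "\<bar>weight \<omega> z t u * outflow z t u\<bar> = base_weight \<pi> ?f * \<bar>\<omega> ?f (row_residual d ?f z) * row_residual d ?f z\<bar>"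
      unfolding abs_mult abs_outflow[OF neighbours_neq[OF that(2)]] weight_def
      using base_weight_bounds[OF row[OF that]] by (simp add: mult.assoc)
    also have "\<dots> \<le> 1 * (K * s)"
      using base_weight_bounds[OF row[OF that]] sel'(4)[OF row[OF that]] by (intro mult_mono) auto
    finally show ?thesis by simp
  qed
  show "m \<le> weight \<omega> z t u" if tu: "t \<in> T0" "u \<in> neighbours T0 t" and r: "\<bar>outflow z t u\<bar> \<le> 2 * a * s"
  proof -
    have "u \<in> T0" "t \<in> T" "u \<in> neighbours T t" using tu T0_T by (auto simp: neighbours_def)
    then show ?thesis
      unfolding weight_def
      using base_weight_clean[OF tu(1)] sel'(3)[OF row] r abs_outflow[OF neighbours_neq[OF tu(2)], of z] by simp
  qed
  show "outflow z t u = deviation z t - deviation z u" if "t \<in> T0" "u \<in> neighbours T0 t"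
    using that by (rule outflow_clean)
next
  show "deviation z p - deviation z q \<le> 2 * (a * s)" if "p \<in> T0" "q \<in> T0" for p q
    using basin that unfolding in_basin_def by blast
qed

text \<open>The new residual is the old one plus the difference of displacements, so the
  stationarity equation becomes an equation for the displacement with frozen fluxes.\<close>

lemma prox_step_equation:
  assumes min: "is_arg_min (prox_objective d \<pi> T C \<mu> (\<lambda>f. \<omega> f (row_residual d f z)) z) (\<lambda>y. y \<in> T \<rightarrow>\<^sub>E UNIV) z'"
    and t: "t \<in> T"
  shows "(\<Sum>u\<in>neighbours T t. weight \<omega> z t u * (outflow z t u + (z' t - z t) - (z' u - z u))) + \<mu> * (z' t - z t) = 0"
proof -
  have "(\<Sum>u\<in>neighbours T t. weight \<omega> z t u * (outflow z t u + (z' t - z t) - (z' u - z u)))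
    = (\<Sum>u\<in>neighbours T t. incidence (row_of C t u) t * (base_weight \<pi> (row_of C t u)
        * \<omega> (row_of C t u) (row_residual d (row_of C t u) z) * row_residual d (row_of C t u) z'))"
  proof (rule sum.cong[OF refl])
    fix u assume "u \<in> neighbours T t"
    note diff = row_of_residual_diff[OF neighbours_neq[OF this], of C d z' z]
    show "weight \<omega> z t u * (outflow z t u + (z' t - z t) - (z' u - z u))
      = incidence (row_of C t u) t * (base_weight \<pi> (row_of C t u)
        * \<omega> (row_of C t u) (row_residual d (row_of C t u) z) * row_residual d (row_of C t u) z')"
      unfolding weight_def outflow_def diff[symmetric] by (simp only: mult_ac)
  qed
  then show ?thesis
    using prox_stationary[OF rows finite_T t min] sum_rows[OF rows finite_T t] by simp
qed

lemma orbit_in_basin: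
  assumes orbit: "prox_MM_orbit \<rho> s a m K (real n / (4 * G)) d \<pi> T C \<omega> z" and s: "0 < s"
    and start: "in_basin (a * s) (z 0)"
  shows "in_basin (a * s) (z j)"
proof (induction j)
  case (Suc j)
  have sel: "\<forall>f\<in>C. admissible_selection \<rho> s a m K (\<omega> j f)"
    and min: "is_arg_min (prox_objective d \<pi> T C (real n / (4 * G)) (\<lambda>f. \<omega> j f (row_residual d f (z j))) (z j))
            (\<lambda>y. y \<in> T \<rightarrow>\<^sub>E UNIV) (z (Suc j))"
    using orbit unfolding prox_MM_orbit_def by blast+
  interpret B: clean_basin n E0 Eb "c * real n" T a m K G c s "weight (\<omega> j) (z j)" "outflow (z j)" "deviation (z j)"
    using basin_step[OF sel s Suc] .
  have dev: "deviation (z (Suc j)) p = deviation (z j) p + (z (Suc j) p - z j p)" for p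
    by (simp add: deviation_def)
  show ?case
    unfolding in_basin_def dev
    using B.prox_step_in_basin[OF a H refl prox_step_equation[of "real n / (4 * G)" "\<omega> j" "z j", OF min]] by blast
qed (rule start)

lemma stopped_in_basin:
  assumes sel: "\<forall>f\<in>C. admissible_selection \<rho> s a m K (\<omega> f)" and s: "0 < s" and basin: "in_basin (a * s) z"
    and stop: "sup_norm T (stationarity_residual d \<pi> C \<omega> z) \<le> real n / G * M"
  shows "in_basin (M + 6 * G * K * c * s) z"
proof -
  interpret B: clean_basin n E0 Eb "c * real n" T a m K G c s "weight \<omega> z" "outflow z" "deviation z"
    using basin_step[OF sel s basin] .
  have "\<bar>\<Sum>u\<in>neighbours T t. weight \<omega> z t u * outflow z t u\<bar> \<le> real n / G * M" if t: "t \<in> T0" for t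
  proof -
    have tT: "t \<in> T" using t T0_T by blast
    then have "\<bar>stationarity_residual d \<pi> C \<omega> z t\<bar> \<le> sup_norm T (stationarity_residual d \<pi> C \<omega> z)"
      unfolding sup_norm_def using finite_T by (intro Max_ge) auto
    then show ?thesis using stop unfolding stationarity_residual_eq[OF tT] by linarith
  qed
  then show ?thesis unfolding in_basin_def using B.stationary_in_basin by blast
qed

lemma stopping_rule_reached:
  assumes orbit: "prox_MM_orbit \<rho> s a m K \<mu> d \<pi> T C \<omega> z" and \<mu>: "0 < \<mu>"
    and \<rho>: "\<And>r. 0 \<le> \<rho> r" and L: "0 < L"
  shows "\<exists>j. sup_norm T (stationarity_residual d \<pi> C (\<omega> j) (z j)) \<le> L"
proof -
  have z0: "z 0 \<in> T \<rightarrow>\<^sub>E UNIV"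
    and sel: "\<And>j f. f \<in> C \<Longrightarrow> admissible_selection \<rho> s a m K (\<omega> j f)"
    and min: "\<And>j. is_arg_min (prox_objective d \<pi> T C \<mu> (\<lambda>f. \<omega> j f (row_residual d f (z j))) (z j))
            (\<lambda>y. y \<in> T \<rightarrow>\<^sub>E UNIV) (z (Suc j))"
    using orbit unfolding prox_MM_orbit_def by blast+
  have z: "z j \<in> T \<rightarrow>\<^sub>E UNIV" for j
    using z0 min[of "j - 1"] by (cases j) (simp_all add: is_arg_min_def)
  \<comment> \<open>By the step equation a residual is at most \<open>3 * n\<close> terms of size
    \<open>2 * \<epsilon>\<close> plus \<open>\<mu> * \<epsilon>\<close>; the sum is
    \<open>L\<close>.\<close>
  define \<epsilon> where "\<epsilon> = L / (6 * real n + \<mu>)"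
  have \<epsilon>: "0 < \<epsilon>" using L \<mu> n_pos by (simp add: \<epsilon>_def)
  have "\<exists>j. (\<Sum>t\<in>T. (z (Suc j) t - z j t)\<^sup>2) \<le> \<epsilon>\<^sup>2"
  proof (rule small_term_if_bounded_sums)
    show "0 \<le> (\<Sum>f\<in>C. base_weight \<pi> f * \<rho> (row_residual d f (z j)))" for j
      using base_weight_bounds \<rho> by (intro sum_nonneg mult_nonneg_nonneg) auto
    show "(\<Sum>f\<in>C. base_weight \<pi> f * \<rho> (row_residual d f (z (Suc j)))) + \<mu> / 2 * (\<Sum>t\<in>T. (z (Suc j) t - z j t)\<^sup>2)
      \<le> (\<Sum>f\<in>C. base_weight \<pi> f * \<rho> (row_residual d f (z j)))" for j
      using finite_row_set[OF rows finite_T] base_weight_bounds(1) sel z min by (rule prox_descent)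
  qed (use \<mu> \<epsilon> in auto)
  then obtain j where j: "(\<Sum>t\<in>T. (z (Suc j) t - z j t)\<^sup>2) \<le> \<epsilon>\<^sup>2" by blast
  have step: "\<bar>z (Suc j) t - z j t\<bar> \<le> \<epsilon>" if "t \<in> T" for t
  proof -
    have "(z (Suc j) t - z j t)\<^sup>2 \<le> (\<Sum>t\<in>T. (z (Suc j) t - z j t)\<^sup>2)"
      using finite_T that by (intro member_le_sum) auto
    then have "\<bar>z (Suc j) t - z j t\<bar>\<^sup>2 \<le> \<epsilon>\<^sup>2" using j by simp
    then show ?thesis using \<epsilon> by (simp add: abs_le_square_iff[symmetric])
  qed
  have "\<bar>stationarity_residual d \<pi> C (\<omega> j) (z j) t\<bar> \<le> L" if t: "t \<in> T" for t
  proof -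
    let ?\<Delta> = "\<lambda>t. z (Suc j) t - z j t" and ?W = "weight (\<omega> j) (z j)"
    have "(\<Sum>u\<in>neighbours T t. ?W t u * (outflow (z j) t u + ?\<Delta> t - ?\<Delta> u))
      = stationarity_residual d \<pi> C (\<omega> j) (z j) t + (\<Sum>u\<in>neighbours T t. ?W t u * (?\<Delta> t - ?\<Delta> u))"
      unfolding stationarity_residual_eq[OF t] sum.distrib[symmetric] by (rule sum.cong[OF refl]) (simp add: algebra_simps)
    then have eq: "stationarity_residual d \<pi> C (\<omega> j) (z j) t
        = - (\<Sum>u\<in>neighbours T t. ?W t u * (?\<Delta> t - ?\<Delta> u)) - \<mu> * ?\<Delta> t"
      using prox_step_equation[of \<mu> "\<omega> j" "z j", OF min t] by linarith
    have "\<bar>\<Sum>u\<in>neighbours T t. ?W t u * (?\<Delta> t - ?\<Delta> u)\<bar> \<le> (\<Sum>u\<in>neighbours T t. 2 * \<epsilon>)"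
    proof (rule order_trans[OF sum_abs sum_mono])
      fix u assume u: "u \<in> neighbours T t"
      then have "u \<in> T" by (simp add: neighbours_def)
      then have "\<bar>?\<Delta> t - ?\<Delta> u\<bar> \<le> 2 * \<epsilon>" using step[OF t] step[of u] by linarith
      moreover have "\<bar>?W t u\<bar> \<le> 1"
      proof -
        let ?f = "row_of C t u"
        have f: "?f \<in> C" using row_of_mem[OF rows t u] .
        have "0 \<le> \<omega> j ?f r" "\<omega> j ?f r \<le> 1" for r
          using sel[OF f, of j] unfolding admissible_selection_def MM_selector_def by blast+
        then show ?thesis unfolding weight_def using base_weight_bounds[OF f] by (simp add: mult_le_one abs_mult)
      qed
      ultimately have "\<bar>?W t u\<bar> * \<bar>?\<Delta> t - ?\<Delta> u\<bar> \<le> 1 * (2 * \<epsilon>)" by (intro mult_mono) auto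
      then show "\<bar>?W t u * (?\<Delta> t - ?\<Delta> u)\<bar> \<le> 2 * \<epsilon>" by (simp add: abs_mult)
    qed
    also have "\<dots> \<le> 3 * real n * (2 * \<epsilon>)"
    proof -
      have "card (neighbours T t) \<le> 3 * n" using card_neighbours_K_triples[OF T_K_triples] t T_K_triples by blast
      then have "real (card (neighbours T t)) \<le> 3 * real n" by linarith
      then show ?thesis unfolding sum_constant using \<epsilon> by (intro mult_right_mono) auto
    qed
    finally have 1: "\<bar>\<Sum>u\<in>neighbours T t. ?W t u * (?\<Delta> t - ?\<Delta> u)\<bar> \<le> 3 * real n * (2 * \<epsilon>)" .
    have 2: "\<bar>\<mu> * ?\<Delta> t\<bar> \<le> \<mu> * \<epsilon>" using step[OF t] \<mu> by (simp add: abs_mult)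
    have "\<bar>stationarity_residual d \<pi> C (\<omega> j) (z j) t\<bar> \<le> 3 * real n * (2 * \<epsilon>) + \<mu> * \<epsilon>"
      unfolding eq using 1 2 by linarith
    also have "\<dots> = (6 * real n + \<mu>) * \<epsilon>" by (simp add: algebra_simps)
    also have "\<dots> = L" using \<mu> n_pos unfolding \<epsilon>_def by (simp add: field_simps)
    finally show ?thesis .
  qed
  then have "sup_norm T (stationarity_residual d \<pi> C (\<omega> j) (z j)) \<le> L"
    unfolding sup_norm_def using finite_T T_nonempty(2) by (intro Max.boundedI) auto
  then show ?thesis by blast
qed

lemma small_residuals_in_basin:
  assumes R: "4 / a * LS_max_residual d \<pi> C z \<le> s" and s: "0 < s"
  shows "in_basin (a * s) z"
proof -
  let ?S = "{\<bar>row_residual d f z\<bar> | f. f \<in> C \<and> 0 < base_weight \<pi> f}"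
  have fin: "finite ?S"
    by (rule finite_subset[of _ "(\<lambda>f. \<bar>row_residual d f z\<bar>) ` C"])
      (use finite_row_set[OF rows finite_T] in blast)+
  have R': "LS_max_residual d \<pi> C z \<le> a * s / 4" using R a by (simp add: field_simps)
  have "\<bar>deviation z t - deviation z u\<bar> \<le> a * s / 4" if tu: "t \<in> T0" "u \<in> neighbours T0 t" for t u
  proof -
    have mem: "t \<in> T" "u \<in> neighbours T t" "u \<in> T0" using tu T0_T by (auto simp: neighbours_def)
    have "\<bar>row_residual d (row_of C t u) z\<bar> \<in> ?S"
      using row_of_mem[OF rows mem(1,2)] base_weight_clean[OF tu(1) mem(3)]
      by (intro CollectI exI[of _ "row_of C t u"]) simp
    then have "\<bar>row_residual d (row_of C t u) z\<bar> \<le> LS_max_residual d \<pi> C z"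
      unfolding LS_max_residual_def using fin by (intro Max_ge)
    then show ?thesis
      using R' abs_outflow[OF neighbours_neq[OF tu(2)], of z] outflow_clean[OF tu, of z] by simp
  qed
  from clean_diameter[of "deviation z", OF this _ seven_D] a s
  have diam: "\<bar>deviation z p - deviation z q\<bar> \<le> 5 * (a * s / 4)" if "p \<in> T0" "q \<in> T0" for p q
    using that by simp
  have "5 * (a * s / 4) \<le> 2 * (a * s)" using a s by simp
  then show ?thesis unfolding in_basin_def using diam by (meson abs_ge_self order_trans)
qed

lemma max_deviation_nonneg: "0 \<le> Max ((\<lambda>t. \<bar>z t - true_log_scale x d t - \<alpha>\<bar>) ` T0)"
proof -
  obtain t where "t \<in> T0" using T_nonempty(1) by blast
  then have "\<bar>z t - true_log_scale x d t - \<alpha>\<bar> \<le> Max ((\<lambda>t. \<bar>z t - true_log_scale x d t - \<alpha>\<bar>) ` T0)"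
    using finite_T0 by (intro Max_ge) auto
  then show ?thesis by linarith
qed

lemma clean_err_le:
  assumes "in_basin v z"
  shows "clean_err T0 (true_log_scale x d) z \<le> v"
    and "\<exists>\<alpha>. \<forall>t\<in>T0. \<bar>z t - true_log_scale x d t - \<alpha>\<bar> \<le> v"
proof -
  obtain \<alpha> b p q where b: "p \<in> T0" "q \<in> T0" "deviation z p - deviation z q = 2 * b"
    "\<forall>t\<in>T0. \<bar>deviation z t - \<alpha>\<bar> \<le> b"
    using half_range[OF finite_T0 T_nonempty(1), of "deviation z"] by blast
  have "deviation z p - deviation z q \<le> 2 * v" using assms b(1,2) unfolding in_basin_def by blast
  then have "b \<le> v" using b(3) by simp
  then have \<alpha>: "\<bar>z t - true_log_scale x d t - \<alpha>\<bar> \<le> v" if "t \<in> T0" for t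
    using b(4) that unfolding deviation_def by force
  then show "\<exists>\<alpha>. \<forall>t\<in>T0. \<bar>z t - true_log_scale x d t - \<alpha>\<bar> \<le> v" by blast
  let ?m = "\<lambda>\<alpha>. Max ((\<lambda>t. \<bar>z t - true_log_scale x d t - \<alpha>\<bar>) ` T0)"
  have "bdd_below (range ?m)" by (rule bdd_belowI[of _ 0]) (use max_deviation_nonneg in auto)
  then have "clean_err T0 (true_log_scale x d) z \<le> ?m \<alpha>"
    unfolding clean_err_def by (rule cINF_lower) simp
  also have "?m \<alpha> \<le> v" using \<alpha> finite_T0 T_nonempty(1) by (intro Max.boundedI) auto
  finally show "clean_err T0 (true_log_scale x d) z \<le> v" .
qed

lemma clean_err_nonneg: "0 \<le> clean_err T0 (true_log_scale x d) z"
  unfolding clean_err_def by (rule cINF_greatest) (use max_deviation_nonneg in auto)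

text \<open>The lower bound on the ratio of scales is precisely positivity of the stopping margin.
  Each scale then passes the basin on: start, orbit, stopped iterate, next start.\<close>

lemma schedule_in_basin:
  assumes \<rho>: "\<And>k r. 0 \<le> \<rho> (\<sigma> k) r"
    and sched: "admissible_schedule (6 * G * K * c / a) \<sigma>"
    and start: "4 / a * LS_max_residual d \<pi> C (z 0 0) \<le> \<sigma> 0"
    and orbit: "\<And>k. prox_MM_orbit (\<rho> (\<sigma> k)) (\<sigma> k) a m K (real n / (4 * G)) d \<pi> T C (\<omega> k) (z k)"
    and stop: "stopping_indices (\<lambda>k j. sup_norm T (stationarity_residual d \<pi> C (\<omega> k j) (z k j))
        \<le> real n / G * (a * \<sigma> (Suc k) - 6 * G * K * c * \<sigma> k)) stop"
    and warm: "\<And>k. z (Suc k) 0 = z k (stop k)"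
  shows "0 < a * \<sigma> (Suc k) - 6 * G * K * c * \<sigma> k"
    and "in_basin (a * \<sigma> k) (z k j)"
    and "\<exists>j. sup_norm T (stationarity_residual d \<pi> C (\<omega> k j) (z k j))
        \<le> real n / G * (a * \<sigma> (Suc k) - 6 * G * K * c * \<sigma> k)"
    and "in_basin (a * \<sigma> (Suc k)) (z k (stop k))"
proof -
  have \<sigma>: "0 < \<sigma> k" "6 * G * K * c / a < \<sigma> (Suc k) / \<sigma> k" for k
    using sched unfolding admissible_schedule_def by blast+
  have "32 / 7 * (1 - 6 * (32 / 7) * (1 - m)) \<le> 32 / 7 * 1" using m by (intro mult_left_mono) auto
  then have "32 / 7 \<le> 32 / 7 / (1 - 6 * (32 / 7) * (1 - m))" using G(1) by (subst pos_le_divide_eq) auto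
  then have G0: "0 < G" using G(2) by linarith
  have M: "0 < a * \<sigma> (Suc k) - 6 * G * K * c * \<sigma> k" for k
    using \<sigma>(2)[of k] \<sigma>(1)[of k] a by (simp add: field_simps)
  \<comment> \<open>Reachability rests on descent alone. Having it before any basin claim makes the
    conditional \<open>stopping_indices\<close> usable inside the induction.\<close>
  have reach: "\<exists>j. sup_norm T (stationarity_residual d \<pi> C (\<omega> k j) (z k j))
        \<le> real n / G * (a * \<sigma> (Suc k) - 6 * G * K * c * \<sigma> k)" for k
    by (rule stopping_rule_reached[OF orbit _ \<rho>]) (use G0 n_pos M in simp_all)
  have sel: "\<forall>f\<in>C. admissible_selection (\<rho> (\<sigma> k)) (\<sigma> k) a m K (\<omega> k j f)" for k j
    using orbit[of k] unfolding prox_MM_orbit_def by blast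
  have step: "in_basin (a * \<sigma> (Suc k)) (z k (stop k))" if "in_basin (a * \<sigma> k) (z k 0)" for k
  proof -
    have "sup_norm T (stationarity_residual d \<pi> C (\<omega> k (stop k)) (z k (stop k)))
        \<le> real n / G * (a * \<sigma> (Suc k) - 6 * G * K * c * \<sigma> k)"
      using stop reach[of k] unfolding stopping_indices_def by blast
    from stopped_in_basin[OF sel \<sigma>(1) orbit_in_basin[OF orbit \<sigma>(1) that] this]
    show ?thesis by simp
  qed
  have 0: "in_basin (a * \<sigma> k) (z k 0)" for k
  proof (induction k)
    case 0
    show ?case using small_residuals_in_basin[OF start \<sigma>(1)] .
  next
    case (Suc k)
    then show ?case unfolding warm by (rule step)
  qed
  show "0 < a * \<sigma> (Suc k) - 6 * G * K * c * \<sigma> k" by (rule M)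
  show "in_basin (a * \<sigma> k) (z k j)" by (rule orbit_in_basin[OF orbit \<sigma>(1) 0])
  show "\<exists>j. sup_norm T (stationarity_residual d \<pi> C (\<omega> k j) (z k j))
        \<le> real n / G * (a * \<sigma> (Suc k) - 6 * G * K * c * \<sigma> k)" by (rule reach)
  show "in_basin (a * \<sigma> (Suc k)) (z k (stop k))" by (rule step[OF 0])
qed

end

section \<open>From the hypotheses of the theorem to a run\<close>

lemma max_corruption_ge:
  assumes "i \<in> {1..n}"
  shows "card {e \<in> Eb. fst e = i \<or> snd e = i} \<le> max_corruption n Eb"
  unfolding max_corruption_def using assms by (intro Max_ge) auto

lemma MM_admissible_nonneg:
  assumes "redescending_MM_admissible \<rho> a m K"
  shows "0 \<le> K" and "0 < s \<Longrightarrow> 0 \<le> \<rho> s r"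
proof -
  obtain q :: "real \<Rightarrow> real" and \<omega> where "MM_selector q 1 a m K \<omega>"
    using assms zero_less_one unfolding redescending_MM_admissible_def by blast
  then have "\<bar>\<omega> 0 * 0\<bar> \<le> K * 1" unfolding MM_selector_def by blast
  then show "0 \<le> K" by simp
  assume "0 < s"
  then obtain q :: "real \<Rightarrow> real" where "\<forall>r. \<rho> s r = q (r\<^sup>2)" "\<forall>v\<ge>0. 0 \<le> q v"
    using assms unfolding redescending_MM_admissible_def by blast
  then show "0 \<le> \<rho> s r" by simp
qed

lemma geometric_schedule:
  assumes "0 \<le> L" "L < \<tau>" "\<tau> < 1" "0 < s"
  shows "admissible_schedule L (\<lambda>k. s * \<tau> ^ k)"
proof -
  have \<tau>: "0 < \<tau>" using assms by linarith
  have "decseq (\<lambda>k. s * \<tau> ^ k)"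
    using \<tau> assms by (intro decseq_SucI mult_left_mono) (auto simp: mult_le_cancel_right1)
  moreover have "(\<lambda>k. s * \<tau> ^ k) \<longlonglongrightarrow> s * 0"
    using \<tau> assms by (intro tendsto_intros LIMSEQ_realpow_zero) auto
  ultimately show ?thesis using \<tau> assms by (simp add: admissible_schedule_def)
qed

theorem theoremG12:
  fixes \<rho> :: "real \<Rightarrow> real \<Rightarrow> real"
    and a m\<^sub>a K G\<^sub>J \<delta>\<^sub>J \<beta>\<^sub>a G\<^sub>a \<kappa>\<^sub>a J\<^sub>a c :: real
  assumes "0 < a" and "0 < m\<^sub>a" and "m\<^sub>a \<le> 1"
    and "redescending_MM_admissible \<rho> a m\<^sub>a K"
    and "G\<^sub>J = 32 / 7" and "\<delta>\<^sub>J = 1 / 384"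
    and "\<beta>\<^sub>a = 6 * G\<^sub>J * (1 - m\<^sub>a)" and "\<beta>\<^sub>a < 1"
    and "G\<^sub>a \<ge> G\<^sub>J / (1 - \<beta>\<^sub>a)"
    and "\<kappa>\<^sub>a = 1 / (4 * G\<^sub>a)" and "J\<^sub>a = K + a"
    and "0 < c" and "c < \<delta>\<^sub>J"
    and "12 * G\<^sub>a * c * a + 6 * G\<^sub>a * J\<^sub>a * c * (1 + 12 * c / \<kappa>\<^sub>a) * (1 + 3 / \<kappa>\<^sub>a) < a / 2"
  shows "(\<forall>\<tau> s. 0 < s \<and> 6 * G\<^sub>a * K * c / a < \<tau> \<and> \<tau> < 1 \<longrightarrow>
            admissible_schedule (6 * G\<^sub>a * K * c / a) (\<lambda>k. s * \<tau> ^ k)) \<and>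
    (\<exists>N :: nat. \<forall>n \<ge> N. \<forall>x E0 Eb d \<pi> C zLS \<sigma> \<omega> z stop.
       let T = retained_triangles n d;
           T0 = clean_triples n E0;
           err = clean_err T0 (true_log_scale x d);
           \<mu> = \<kappa>\<^sub>a * real n;
           M = (\<lambda>k. a * \<sigma> (Suc k) - 6 * G\<^sub>a * K * c * \<sigma> k);
           g = (\<lambda>k m. stationarity_residual d \<pi> C (\<omega> k m) (z k m));
           reached = (\<lambda>k m. sup_norm T (g k m) \<le> real n / G\<^sub>a * M k);
           out = (\<lambda>k. z k (stop k))
       in
       camera_model n x E0 Eb d \<and>
       reliability_scores T T0 \<pi> \<and>
       is_row_set T C \<and>
       admissible_schedule (6 * G\<^sub>a * K * c / a) \<sigma> \<and>
       is_arg_min (LS_objective d \<pi> C) (\<lambda>y. y \<in> T \<rightarrow>\<^sub>E UNIV) zLS \<and>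
       \<sigma> 0 \<ge> 4 / a * LS_max_residual d \<pi> C zLS \<and>
       (\<forall>k. prox_MM_orbit (\<rho> (\<sigma> k)) (\<sigma> k) a m\<^sub>a K \<mu> d \<pi> T C (\<omega> k) (z k)) \<and>
       stopping_indices reached stop \<and>
       warm_started zLS stop z \<and>
       real (max_corruption n Eb) \<le> c * real n
       \<longrightarrow>
       (\<forall>k. 0 < M k) \<and>
       (\<forall>k m. err (z k m) \<le> a * \<sigma> k) \<and>
       (\<forall>k. \<exists>m. reached k m) \<and>
       (\<forall>k. err (out k) \<le> a * \<sigma> (Suc k)) \<and>
       ((\<forall>k. \<exists>\<alpha>. \<forall>t \<in> T0. \<bar>out k t - true_log_scale x d t - \<alpha>\<bar> \<le> a * \<sigma> (Suc k)) \<and>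
        (\<lambda>k. a * \<sigma> (Suc k)) \<longlonglongrightarrow> 0 \<and>
        (\<lambda>k. err (out k)) \<longlonglongrightarrow> 0) \<and>
       (\<forall>\<tau>. (\<forall>k. \<sigma> (Suc k) = \<tau> * \<sigma> k) \<longrightarrow>
          (\<forall>k. a * \<sigma> (Suc k) = a * \<sigma> 0 * \<tau> ^ (k + 1))))"
proof -
  note a = assms(1) and m = assms(3) and adm = assms(4) and c = assms(12,13)
  have K: "0 \<le> K" using MM_admissible_nonneg(1)[OF adm] .
  have G: "6 * (32 / 7) * (1 - m\<^sub>a) < 1" "32 / 7 / (1 - 6 * (32 / 7) * (1 - m\<^sub>a)) \<le> G\<^sub>a"
    using assms(8,9) unfolding assms(7) unfolding assms(5) .
  have "0 < 32 / 7 / (1 - 6 * (32 / 7) * (1 - m\<^sub>a))" using G(1) by simp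
  then have G0: "0 < G\<^sub>a" using G(2) by linarith
  \<comment> \<open>Substituting \<open>\<kappa>\<^sub>a = 1 / (4 * G\<^sub>a)\<close> turns
    \<open>12 * c / \<kappa>\<^sub>a\<close> into \<open>48 * G\<^sub>a * c\<close> and
    \<open>3 / \<kappa>\<^sub>a\<close> into \<open>12 * G\<^sub>a\<close>.\<close>
  have H: "12 * G\<^sub>a * c * a + 6 * G\<^sub>a * (K + a) * c * (1 + 48 * G\<^sub>a * c) * (1 + 12 * G\<^sub>a) < a / 2"
    using assms(14) unfolding assms(10,11) by (simp add: mult_ac)
  have L: "0 \<le> 6 * G\<^sub>a * K * c / a" using G0 K a c by simp
  have run: "(\<forall>k. 0 < a * \<sigma> (Suc k) - 6 * G\<^sub>a * K * c * \<sigma> k) \<and>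
      (\<forall>k j. clean_err (clean_triples n E0) (true_log_scale x d) (z k j) \<le> a * \<sigma> k) \<and>
      (\<forall>k. \<exists>j. sup_norm (retained_triangles n d) (stationarity_residual d \<pi> C (\<omega> k j) (z k j))
        \<le> real n / G\<^sub>a * (a * \<sigma> (Suc k) - 6 * G\<^sub>a * K * c * \<sigma> k)) \<and>
      (\<forall>k. clean_err (clean_triples n E0) (true_log_scale x d) (z k (stop k)) \<le> a * \<sigma> (Suc k)) \<and>
      ((\<forall>k. \<exists>\<alpha>. \<forall>t\<in>clean_triples n E0. \<bar>z k (stop k) t - true_log_scale x d t - \<alpha>\<bar> \<le> a * \<sigma> (Suc k)) \<and>
       (\<lambda>k. a * \<sigma> (Suc k)) \<longlonglongrightarrow> 0 \<and>
       (\<lambda>k. clean_err (clean_triples n E0) (true_log_scale x d) (z k (stop k))) \<longlonglongrightarrow> 0) \<and>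
      (\<forall>\<tau>. (\<forall>k. \<sigma> (Suc k) = \<tau> * \<sigma> k) \<longrightarrow> (\<forall>k. a * \<sigma> (Suc k) = a * \<sigma> 0 * \<tau> ^ (k + 1)))"
    if n: "100 \<le> n"
      and model: "camera_model n x E0 Eb d"
      and scores: "reliability_scores (retained_triangles n d) (clean_triples n E0) \<pi>"
      and rows: "is_row_set (retained_triangles n d) C"
      and sched: "admissible_schedule (6 * G\<^sub>a * K * c / a) \<sigma>"
      and start: "4 / a * LS_max_residual d \<pi> C zLS \<le> \<sigma> 0"
      and orbit: "\<forall>k. prox_MM_orbit (\<rho> (\<sigma> k)) (\<sigma> k) a m\<^sub>a K (\<kappa>\<^sub>a * real n) d \<pi> (retained_triangles n d) C (\<omega> k) (z k)"
      and stop: "stopping_indices (\<lambda>k j. sup_norm (retained_triangles n d) (stationarity_residual d \<pi> C (\<omega> k j) (z k j))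
        \<le> real n / G\<^sub>a * (a * \<sigma> (Suc k) - 6 * G\<^sub>a * K * c * \<sigma> k)) stop"
      and warm: "warm_started zLS stop z"
      and corr: "real (max_corruption n Eb) \<le> c * real n"
    for n x E0 Eb d \<pi> C zLS \<sigma> \<omega> z stop
  proof -
    have parts: "E0 \<union> Eb = K_edges n" "E0 \<inter> Eb = {}"
      using model unfolding camera_model_def by (simp_all only: simp_thms)
    interpret R: camera_run n E0 Eb c x d \<pi> C a m\<^sub>a K G\<^sub>a
    proof unfold_locales
      show "0 < n" using n by simp
      show "E0 \<union> Eb = K_edges n" "E0 \<inter> Eb = {}" by (fact parts)+
      show "real (card {e \<in> Eb. fst e = i \<or> snd e = i}) \<le> c * real n" if "i \<in> {1..n}" for i
        using max_corruption_ge[OF that, of Eb] corr by linarith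
      show "c < 1 / 384" using c assms(6) by simp
    qed (fact model scores rows a m K n c G H)+
    have \<sigma>: "0 < \<sigma> k" for k using sched unfolding admissible_schedule_def by blast
    have lim: "\<sigma> \<longlonglongrightarrow> 0" using sched unfolding admissible_schedule_def by blast
    have z0: "z 0 0 = zLS" and warm': "z (Suc k) 0 = z k (stop k)" for k
      using warm unfolding warm_started_def by blast+
    have orbit': "prox_MM_orbit (\<rho> (\<sigma> k)) (\<sigma> k) a m\<^sub>a K (real n / (4 * G\<^sub>a)) d \<pi> R.T C (\<omega> k) (z k)" for k
      using orbit unfolding assms(10) by simp
    note main = R.schedule_in_basin[of \<rho> \<sigma> z \<omega> stop, OF MM_admissible_nonneg(2)[OF adm \<sigma>] sched
        start[folded z0] orbit' stop warm']
    have lim': "(\<lambda>k. a * \<sigma> (Suc k)) \<longlonglongrightarrow> 0"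
      using tendsto_mult[OF tendsto_const[of a] LIMSEQ_Suc[OF lim]] by simp
    note out = R.clean_err_le[OF main(4)]
    have err: "(\<lambda>k. clean_err R.T0 (true_log_scale x d) (z k (stop k))) \<longlonglongrightarrow> 0"
      by (rule real_tendsto_sandwich[OF always_eventually always_eventually tendsto_const lim'])
        (intro allI R.clean_err_nonneg out(1))+
    have geometric: "a * \<sigma> (Suc k) = a * \<sigma> 0 * \<tau> ^ (k + 1)" if "\<forall>k. \<sigma> (Suc k) = \<tau> * \<sigma> k" for \<tau> k
      by (induction k) (simp_all add: that)
    show ?thesis
      by (intro conjI allI impI main(1,3) out lim' err R.clean_err_le(1)[OF main(2)]) (rule geometric)
  qed
  have geometric: "\<forall>\<tau> s. 0 < s \<and> 6 * G\<^sub>a * K * c / a < \<tau> \<and> \<tau> < 1 \<longrightarrow>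
            admissible_schedule (6 * G\<^sub>a * K * c / a) (\<lambda>k. s * \<tau> ^ k)"
    using geometric_schedule[OF L] by blast
  \<comment> \<open>The threshold \<open>100\<close> suffices for the absorption in
    \<open>clean_green\<close> and for \<open>seven_D\<close>, uniformly in all other data.\<close>
  show ?thesis
    by (rule conjI[OF geometric exI[of _ 100]], intro allI impI, unfold Let_def, intro impI,
        elim conjE, rule run; assumption)
qed

end
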